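(* The class of $(P_7,\mathit{domino})$-free bipartite graphs is factorial.
   Context: Graphs are finite, simple and undirected. A graph is $(H_1,H_2)$-free if it contains no induced subgraph isomorphic to $H_1$ or $H_2$. $P_7$ is the chordless path with 7 vertices. The $\mathit{domino}$ is the bipartite graph with parts $\{x_1,x_2,x_3\}$ and $\{y_1,y_2,y_3\}$ and edges $x_1y_1,\ x_1y_2,\ x_2y_1,\ x_2y_2,\ x_2y_3,\ x_3y_2,\ x_3y_3$ (equivalently, a cycle $C_6$ with one chord joining two opposite vertices). A hereditary class (one closed under taking induced subgraphs) is factorial if the number of labelled graphs in it with vertex set $\{1,\ldots,n\}$ is $2^{\Theta(n\log n)}$. *)

theory Defs
  imports Complex_Main "HOL-Library.Landau_Symbols"
begin

type_synonym 'a graph = "'a set \<times> 'a set set"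

abbreviation verts :: "'a graph \<Rightarrow> 'a set" where
  "verts G \<equiv> fst G"

abbreviation edges :: "'a graph \<Rightarrow> 'a set set" where
  "edges G \<equiv> snd G"

definition simple_graph :: "'a graph \<Rightarrow> bool" where
  "simple_graph G \<longleftrightarrow> finite (verts G) \<and>
     (\<forall>e\<in>edges G. \<exists>u\<in>verts G. \<exists>v\<in>verts G. u \<noteq> v \<and> e = {u, v})"

definition induced_subgraph :: "'a graph \<Rightarrow> 'a set \<Rightarrow> 'a graph" where
  "induced_subgraph G W = (W, {e \<in> edges G. e \<subseteq> W})"

definition graph_iso :: "'a graph \<Rightarrow> 'b graph \<Rightarrow> bool" where
  "graph_iso G H \<longleftrightarrow> (\<exists>f. bij_betw f (verts G) (verts H) \<and>
     (\<forall>u\<in>verts G. \<forall>v\<in>verts G. {u, v} \<in> edges G \<longleftrightarrow> {f u, f v} \<in> edges H))"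

definition contains_induced :: "'a graph \<Rightarrow> 'b graph \<Rightarrow> bool" where
  "contains_induced G H \<longleftrightarrow> (\<exists>W \<subseteq> verts G. graph_iso (induced_subgraph G W) H)"

definition free2 :: "'b graph \<Rightarrow> 'c graph \<Rightarrow> 'a graph \<Rightarrow> bool" where
  "free2 H1 H2 G \<longleftrightarrow> \<not> contains_induced G H1 \<and> \<not> contains_induced G H2"

definition bipartite :: "'a graph \<Rightarrow> bool" where
  "bipartite G \<longleftrightarrow> (\<exists>A B. A \<union> B = verts G \<and> A \<inter> B = {} \<and>
     (\<forall>e\<in>edges G. \<exists>a\<in>A. \<exists>b\<in>B. e = {a, b}))"

text \<open>The chordless path with \<open>k\<close> vertices (not \<open>k\<close> edges).\<close>

definition path_graph :: "nat \<Rightarrow> nat graph" where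
  "path_graph k = ({1..k}, {{i, i + 1} |i. 1 \<le> i \<and> i < k})"

text \<open>Here \<open>Inl i\<close> stands for \<open>x\<^sub>i\<close> and \<open>Inr j\<close> for \<open>y\<^sub>j\<close>.\<close>

definition domino :: "(nat + nat) graph" where
  "domino = (Inl ` {1, 2, 3} \<union> Inr ` {1, 2, 3},
     {{Inl 1, Inr 1}, {Inl 1, Inr 2},
      {Inl 2, Inr 1}, {Inl 2, Inr 2}, {Inl 2, Inr 3},
      {Inl 3, Inr 2}, {Inl 3, Inr 3}})"

text \<open>
  Graph classes are represented as sets of graphs with vertices in \<open>nat\<close>; every finite graph
  has an isomorphic copy of this kind. As usual for graph classes, induced subgraphs are taken
  up to isomorphism, so a hereditary class is in particular closed under isomorphism.
\<close>

definition hereditary :: "nat graph set \<Rightarrow> bool" where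
  "hereditary X \<longleftrightarrow> (\<forall>G\<in>X. simple_graph G) \<and>
     (\<forall>G\<in>X. \<forall>H. simple_graph H \<longrightarrow> contains_induced G H \<longrightarrow> H \<in> X)"

definition labelled_graphs :: "nat graph set \<Rightarrow> nat \<Rightarrow> nat graph set" where
  "labelled_graphs X n = {G \<in> X. verts G = {1..n}}"

text \<open>The base of the logarithm is immaterial under \<open>\<Theta>\<close>.\<close>

definition factorial_class :: "nat graph set \<Rightarrow> bool" where
  "factorial_class X \<longleftrightarrow> hereditary X \<and>
     (\<exists>f :: nat \<Rightarrow> real. f \<in> \<Theta>(\<lambda>n. real n * ln (real n)) \<and>
        (\<forall>\<^sub>F n in sequentially. real (card (labelled_graphs X n)) = 2 powr f n))"

end

theory Submission
  imports Defs "HOL-Library.FuncSet"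
begin

text \<open>
  The lower bound is a count of star forests. For the upper bound, every vertex of a graph in the
  class gets seven labels, each one a number at most \<open>n + 3\<close>, in such a way that the labels
  determine the edges; this gives at most \<open>(n + 4) ^ (7 * n)\<close> graphs.

  The meaning of ``domino-free'' for a bipartite graph is that, for each vertex \<open>z\<close>, the sets
  \<open>N(a) \<inter> N(z)\<close> form a laminar family: any two of them are disjoint or nested. A laminar family
  is cheap to encode, because its ground set can be ordered so that each member is an interval
  (\<open>laminar_interval_order\<close>).

  Choose \<open>x\<close> with the most vertices at distance 2. By \<open>P\<^sub>7\<close>-freeness no vertex is then at
  distance 4 from \<open>x\<close>, so the component of \<open>x\<close> consists of \<open>{x}\<close> and three distance layers
  \<open>L\<^sub>1, L\<^sub>2, L\<^sub>3\<close>. The edges between \<open>L\<^sub>1 = N(x)\<close> and \<open>L\<^sub>2\<close> are given by a laminar family. It remains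
  to encode the edges between \<open>L\<^sub>2\<close> and \<open>L\<^sub>3\<close>, and here \<open>P\<^sub>7\<close>-freeness is used once more: if
  \<open>a, b \<in> L\<^sub>2\<close> have no common neighbour in \<open>L\<^sub>1\<close>, their neighbourhoods in \<open>L\<^sub>3\<close> are comparable.

  The encoding of that last graph (\<open>windows_exist\<close>) is a recursion on sets \<open>J \<subseteq> L\<^sub>2\<close>, in which a
  set \<open>P\<close> of already processed vertices, with \<open>L\<^sub>1 \<subseteq> P\<close>, traces a laminar family on \<open>J\<close>. Let
  \<open>z \<in> J\<close> have a largest trace \<open>N(z) \<inter> P\<close>. If all the other traces lie inside it, then the
  neighbours of \<open>z\<close> that are still unprocessed can be added to \<open>P\<close>: all traces on the new \<open>P\<close> are
  traces on \<open>N(z)\<close>, so they are laminar by domino-freeness. Then \<open>z\<close> is removed from \<open>J\<close>.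
  Otherwise the members of \<open>J\<close> whose traces lie inside that of \<open>z\<close> have no common neighbour in
  \<open>L\<^sub>1\<close> with the remaining ones; comparability across the two parts then produces a partition
  \<open>J = J\<^sub>1 \<union> J\<^sub>2\<close> such that each unprocessed vertex is complete to \<open>J\<^sub>2\<close> or has no neighbour in
  \<open>J\<^sub>1\<close>, and \<open>J\<^sub>1\<close> and \<open>J\<^sub>2\<close> are treated independently.
  Placing \<open>z\<close> first in its set, and \<open>J\<^sub>1\<close> before \<open>J\<^sub>2\<close>, makes every set of the recursion an interval
  of positions, so that a vertex of \<open>L\<^sub>3\<close> only has to record the interval of the set in which it was
  processed and the least of its neighbours there.
\<close>

section \<open>Laminar families\<close>

definition laminar :: "'i set \<Rightarrow> ('i \<Rightarrow> 'b set) \<Rightarrow> bool" where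
  "laminar I F \<longleftrightarrow> (\<forall>i\<in>I. \<forall>j\<in>I. F i \<inter> F j = {} \<or> F i \<subseteq> F j \<or> F j \<subseteq> F i)"

lemma finite_argmax:
  fixes f :: "'a \<Rightarrow> nat"
  assumes "finite S" "S \<noteq> {}"
  obtains z where "z \<in> S" "\<And>a. a \<in> S \<Longrightarrow> f a \<le> f z"
proof -
  have "Max (f ` S) \<in> f ` S" using assms by (intro Max_in) auto
  then obtain z where "z \<in> S" "f z = Max (f ` S)" by auto
  then show ?thesis using assms that by (metis Max_ge finite_imageI imageI)
qed

lemma finite_argmin:
  fixes f :: "'a \<Rightarrow> nat"
  assumes "finite S" "S \<noteq> {}"
  obtains z where "z \<in> S" "\<And>a. a \<in> S \<Longrightarrow> f z \<le> f a"
proof -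
  have "Min (f ` S) \<in> f ` S" using assms by (intro Min_in) auto
  then obtain z where "z \<in> S" "f z = Min (f ` S)" by auto
  then show ?thesis using assms that by (metis Min_le finite_imageI imageI)
qed

text \<open>
  A largest member \<open>M\<close> apart from the ground set has every other such member either inside it or
  disjoint from it. So orders of \<open>M\<close> and of its complement, obtained recursively, can be put one after the
  other. For the use as an encoding only the half-open intervals of positions matter; two points
  that no member separates may share a position.
\<close>

lemma laminar_interval_order:
  assumes "finite B" "laminar \<F> (\<lambda>X. X)" "\<forall>X\<in>\<F>. X \<subseteq> B"
  shows "\<exists>pos :: 'b \<Rightarrow> nat. (\<forall>b\<in>B. pos b < card B) \<and>
    (\<forall>X\<in>\<F>. \<exists>l h. l \<le> h \<and> h \<le> card B \<and> (\<forall>b\<in>B. b \<in> X \<longleftrightarrow> l \<le> pos b \<and> pos b < h))"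
  using assms
proof (induction "card B" arbitrary: B \<F> rule: less_induct)
  case less
  define \<G> where "\<G> = {X\<in>\<F>. X \<noteq> B \<and> X \<noteq> {}}"
  have trivial: "\<exists>l h. l \<le> h \<and> h \<le> card B \<and> (\<forall>b\<in>B. b \<in> X \<longleftrightarrow> l \<le> pos b \<and> pos b < h)"
    if "X = B \<or> X = {}" "\<forall>b\<in>B. pos b < card B" for X and pos :: "'b \<Rightarrow> nat"
  proof (cases "X = B")
    case True
    then show ?thesis using that by (intro exI[of _ 0] exI[of _ "card B"]) auto
  next
    case False
    then show ?thesis using that by (intro exI[of _ 0]) auto
  qed
  show ?case
  proof (cases "\<G> = {}")
    case True
    have "\<forall>b\<in>B. (\<lambda>_. 0) b < card B" using less.prems(1) by (auto simp: card_gt_0_iff)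
    moreover have "\<forall>X\<in>\<F>. X = B \<or> X = {}" using True unfolding \<G>_def by auto
    ultimately show ?thesis using trivial by (intro exI[of _ "\<lambda>_. 0"]) blast
  next
    case False
    have "\<G> \<subseteq> Pow B" using less.prems(3) unfolding \<G>_def by auto
    then have "finite \<G>" using less.prems(1) finite_subset by auto
    then obtain M where M: "M \<in> \<G>" and Mmax: "\<And>X. X \<in> \<G> \<Longrightarrow> card X \<le> card M"
      using False finite_argmax by metis
    have MB: "M \<subseteq> B" "M \<noteq> B" "M \<noteq> {}" "M \<in> \<F>"
      using M less.prems(3) unfolding \<G>_def by auto
    have finM: "finite M" using MB less.prems(1) finite_subset by blast
    have lt1: "card M < card B" using MB less.prems(1) by (simp add: psubset_card_mono psubset_eq)
    have eq: "card (B - M) = card B - card M" "card M \<le> card B"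
      using MB less.prems(1) finM by (simp_all add: card_Diff_subset card_mono)
    have "card M > 0" using MB finM by (simp add: card_gt_0_iff)
    then have lt2: "card (B - M) < card B" using eq lt1 by linarith
    have lamM: "laminar {X\<in>\<F>. X \<subseteq> M} (\<lambda>X. X)" "laminar {X\<in>\<F>. X \<inter> M = {}} (\<lambda>X. X)"
      using less.prems(2) unfolding laminar_def by auto
    obtain p where p: "\<forall>b\<in>M. p b < card M"
      "\<forall>X\<in>{X\<in>\<F>. X \<subseteq> M}. \<exists>l h. l \<le> h \<and> h \<le> card M \<and>
        (\<forall>b\<in>M. b \<in> X \<longleftrightarrow> l \<le> p b \<and> p b < h)"
      using less.hyps[OF lt1 finM lamM(1)] by auto
    obtain q where q: "\<forall>b\<in>B-M. q b < card (B-M)"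
      "\<forall>X\<in>{X\<in>\<F>. X \<inter> M = {}}. \<exists>l h. l \<le> h \<and> h \<le> card (B-M) \<and>
        (\<forall>b\<in>B-M. b \<in> X \<longleftrightarrow> l \<le> q b \<and> q b < h)"
      using less.hyps[OF lt2 _ lamM(2)] less.prems by blast
    define pos where "pos b = (if b \<in> M then p b else card M + q b)" for b
    have pos: "\<forall>b\<in>B. pos b < card B"
    proof
      fix b assume "b \<in> B"
      then show "pos b < card B"
        using bspec[OF p(1), of b] bspec[OF q(1), of b] eq lt1 unfolding pos_def by auto
    qed
    have "\<exists>l h. l \<le> h \<and> h \<le> card B \<and> (\<forall>b\<in>B. b \<in> X \<longleftrightarrow> l \<le> pos b \<and> pos b < h)"
      if X: "X \<in> \<F>" for X
    proof -
      consider "X = B \<or> X = {}" | "X \<subseteq> M" | "X \<inter> M = {}"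
      proof (cases "X = B \<or> X = {}")
        case False
        then have "X \<in> \<G>" using X unfolding \<G>_def by blast
        moreover have "finite X" using X less.prems(1,3) finite_subset by blast
        moreover have "X \<inter> M = {} \<or> X \<subseteq> M \<or> M \<subseteq> X"
          using less.prems(2) X MB unfolding laminar_def by blast
        ultimately show ?thesis using Mmax card_seteq that by blast
      qed
      then show ?thesis
      proof cases
        case 1
        then show ?thesis using trivial pos by blast
      next
        case 2
        then obtain l h where "l \<le> h" "h \<le> card M" "\<forall>b\<in>M. b \<in> X \<longleftrightarrow> l \<le> p b \<and> p b < h"
          using p(2) X by blast
        then show ?thesis using 2 eq unfolding pos_def
          by (intro exI[of _ l] exI[of _ h]) auto
      next
        case 3
        then obtain l h where "l \<le> h" "h \<le> card (B-M)" "\<forall>b\<in>B-M. b \<in> X \<longleftrightarrow> l \<le> q b \<and> q b < h"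
          using q(2) X by blast
        then show ?thesis using 3 eq p(1) unfolding pos_def
          by (intro exI[of _ "card M + l"] exI[of _ "card M + h"]) (auto simp: le_diff_conv2)
      qed
    qed
    then show ?thesis using pos by blast
  qed
qed

section \<open>Encoding a graph between two layers\<close>

text \<open>
  This is meant for laminar families \<open>F\<close> of nonempty sets, where the members containing \<open>F a0\<close>
  form a chain. The rank \<open>\<rho>\<close> breaks ties between equal sets, so that one element \<open>a0\<close> can stand
  for any upper part of such a chain.
\<close>

definition above :: "('a \<Rightarrow> 'c set) \<Rightarrow> ('a \<Rightarrow> nat) \<Rightarrow> 'a \<Rightarrow> 'a \<Rightarrow> bool" where
  "above F \<rho> a0 a \<longleftrightarrow> F a0 \<subseteq> F a \<and> (F a0 = F a \<longrightarrow> \<rho> a0 \<le> \<rho> a)"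

text \<open>
  Start from an element \<open>m\<close> whose set \<open>N m \<inter> U\<close> is smallest, say on the \<open>K\<close> side; comparability
  puts it below everything on the other side. All elements of \<open>K\<close> with this property can be taken
  as the lower part: any other \<open>b \<in> K\<close> contains some set of the other side, and this in turn
  contains the sets of the lower part.
\<close>

lemma cross_comparable_split:
  assumes fin: "finite J" "finite U"
    and K: "K \<subseteq> J" "K \<noteq> {}" "K \<noteq> J"
    and cmp: "\<And>a b. a \<in> K \<Longrightarrow> b \<in> J - K \<Longrightarrow> N a \<inter> U \<subseteq> N b \<or> N b \<inter> U \<subseteq> N a"
  shows "\<exists>J1. J1 \<subseteq> J \<and> J1 \<noteq> {} \<and> J1 \<noteq> J \<and> (\<forall>a\<in>J1. \<forall>b\<in>J - J1. N a \<inter> U \<subseteq> N b)"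
proof -
  \<comment> \<open>The two sides play symmetric roles; this is the case that the smallest set is on the side \<open>K\<close>.\<close>
  have main: "\<exists>J1. J1 \<subseteq> J \<and> J1 \<noteq> {} \<and> J1 \<noteq> J \<and> (\<forall>a\<in>J1. \<forall>b\<in>J - J1. N a \<inter> U \<subseteq> N b)"
    if K: "K \<subseteq> J" "K \<noteq> J" and m: "m \<in> K" "\<And>b. b \<in> J \<Longrightarrow> card (N m \<inter> U) \<le> card (N b \<inter> U)"
      and cmp: "\<And>a b. a \<in> K \<Longrightarrow> b \<in> J - K \<Longrightarrow> N a \<inter> U \<subseteq> N b \<or> N b \<inter> U \<subseteq> N a" for K m
  proof -
    define J1 where "J1 = {a\<in>K. \<forall>b\<in>J-K. N a \<inter> U \<subseteq> N b}"
    have "N m \<inter> U \<subseteq> N b" if b: "b \<in> J - K" for b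
    proof (rule ccontr)
      assume "\<not> N m \<inter> U \<subseteq> N b"
      then have "N b \<inter> U \<subset> N m \<inter> U" using cmp[OF m(1) b] by auto
      then have "card (N b \<inter> U) < card (N m \<inter> U)" using fin(2) by (simp add: psubset_card_mono)
      then show False using m(2)[of b] b by auto
    qed
    then have "m \<in> J1" using m(1) unfolding J1_def by blast
    moreover have "N a \<inter> U \<subseteq> N b" if a: "a \<in> J1" and b: "b \<in> J - J1" for a b
    proof (cases "b \<in> K")
      case True
      then obtain c where "c \<in> J - K" "\<not> N b \<inter> U \<subseteq> N c" using b unfolding J1_def by blast
      then have "N c \<inter> U \<subseteq> N b" "N a \<inter> U \<subseteq> N c" using cmp[OF True] a unfolding J1_def by auto
      then show ?thesis by blast
    next
      case False
      then show ?thesis using a b unfolding J1_def by blast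
    qed
    moreover have "J1 \<subseteq> K" unfolding J1_def by blast
    ultimately show ?thesis using K by (intro exI[of _ J1]) blast
  qed
  have "J \<noteq> {}" using K by auto
  then obtain m where m: "m \<in> J" "\<And>b. b \<in> J \<Longrightarrow> card (N m \<inter> U) \<le> card (N b \<inter> U)"
    using finite_argmin[OF fin(1), of "\<lambda>a. card (N a \<inter> U)"] by blast
  show ?thesis
  proof (cases "m \<in> K")
    case True
    then show ?thesis using main[OF K(1,3) True m(2) cmp] by blast
  next
    case False
    have "\<And>a b. a \<in> J - K \<Longrightarrow> b \<in> J - (J - K) \<Longrightarrow> N a \<inter> U \<subseteq> N b \<or> N b \<inter> U \<subseteq> N a"
      using cmp by blast
    then show ?thesis using main[of "J - K" m] K m False by blast
  qed
qed

lemma laminar_subset: "laminar I F \<Longrightarrow> J \<subseteq> I \<Longrightarrow> laminar J F"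
  unfolding laminar_def by blast

lemma laminar_Int: "laminar I F \<Longrightarrow> laminar I (\<lambda>i. F i \<inter> S)"
  unfolding laminar_def by blast

lemma laminar_cong: "(\<And>i. i \<in> I \<Longrightarrow> F i = G i) \<Longrightarrow> laminar I F = laminar I G"
  unfolding laminar_def by simp

text \<open>
  The description of one vertex \<open>u\<close> of the outer layer. The positions from \<open>l\<close> up to \<open>h\<close> are those
  of the set in which \<open>u\<close> is processed by the recursion, and \<open>a0\<close> is the lowest neighbour of \<open>u\<close>
  there; for a vertex that is never processed, \<open>l = h\<close> and \<open>a0\<close> is arbitrary. All that comes
  later in the order is adjacent to \<open>u\<close>, all that comes earlier is not. From \<open>h\<close> on the first
  disjunct is true, so the second one carries no upper bound.
\<close>

definition window :: "('a \<Rightarrow> 'c set) \<Rightarrow> 'c set \<Rightarrow> 'a set \<Rightarrow> ('a \<Rightarrow> nat) \<Rightarrow> ('a \<Rightarrow> nat) \<Rightarrow> 'c \<Rightarrow> bool"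
  where "window N B J pos \<rho> u \<longleftrightarrow> (\<exists>l h. \<exists>a0\<in>J. l \<le> h \<and> h \<le> card J \<and>
    (\<forall>a\<in>J. u \<in> N a \<longleftrightarrow> h \<le> pos a \<or> l \<le> pos a \<and> above (\<lambda>a. N a \<inter> B) \<rho> a0 a))"

text \<open>
  When two elements have the same trace on \<open>B\<close>, that trace does not show which of them has the
  larger trace on \<open>P\<close>, so the rank has to record it. This invariant allows one rank function to
  serve all stages of the recursion.
\<close>

definition refines :: "('a \<Rightarrow> 'c set) \<Rightarrow> 'c set \<Rightarrow> 'c set \<Rightarrow> 'a set \<Rightarrow> ('a \<Rightarrow> nat) \<Rightarrow> bool" where
  "refines N B P J \<rho> \<longleftrightarrow> (\<forall>a\<in>J. \<forall>b\<in>J. N a \<inter> B = N b \<inter> B \<longrightarrow> N a \<inter> P \<subset> N b \<inter> P \<longrightarrow> \<rho> a < \<rho> b)"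

text \<open>
  In the application \<open>J\<close> and \<open>B\<close> are the second and first layer, \<open>U\<close> is the third one, and \<open>P = B\<close>
  at the start. The laminarity of all \<open>N a \<inter> N z\<close> is domino-freeness, and the last assumption
  comes from \<open>P\<^sub>7\<close>-freeness. An element of \<open>U\<close> is moved to \<open>P\<close> at the stage at which it is adjacent
  to the chosen element \<open>z\<close>; at that stage the processed traces, including the new ones, are still
  laminar, which makes the neighbours of \<open>u\<close> an upper part of a chain.
\<close>

lemma windows_exist:
  assumes "finite J" "finite U" "finite P" "B \<subseteq> P"
    and "laminar J (\<lambda>a. N a \<inter> P)"
    and "\<And>z. z \<in> J \<Longrightarrow> laminar J (\<lambda>a. N a \<inter> N z)"
    and "\<And>a. a \<in> J \<Longrightarrow> N a \<inter> B \<noteq> {}"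
    and "\<And>a b. a \<in> J \<Longrightarrow> b \<in> J \<Longrightarrow> N a \<inter> N b \<inter> B = {} \<Longrightarrow>
      N a \<inter> U \<subseteq> N b \<or> N b \<inter> U \<subseteq> N a"
  shows "\<exists>pos \<rho>. (\<forall>a\<in>J. pos a < card J) \<and> refines N B P J \<rho> \<and>
    (\<forall>u\<in>U. J = {} \<or> window N B J pos \<rho> u)"
  using assms
proof (induction "card J" arbitrary: J U P rule: less_induct)
  case less
  note fin = less.prems(1-3) and BP = less.prems(4) and lam = less.prems(5)
    and tri = less.prems(6) and ne = less.prems(7) and cmp = less.prems(8)
  show ?case
  proof (cases "J = {}")
    case True
    then show ?thesis by (auto simp: refines_def)
  next
    case False
    obtain z where z: "z \<in> J" "\<And>a. a \<in> J \<Longrightarrow> card (N a \<inter> P) \<le> card (N z \<inter> P)"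
      using finite_argmax[OF fin(1) False, of "\<lambda>a. card (N a \<inter> P)"] by blast
    show ?thesis
    proof (cases "\<forall>a\<in>J. N a \<inter> P \<subseteq> N z")
      case top: True
      define P' where "P' = P \<union> (N z \<inter> U)"
      define J' where "J' = J - {z}"
      have card: "card J = Suc (card J')"
        using z(1) fin(1) unfolding J'_def by (simp only: card.remove)
      have sub: "J' \<subseteq> J" unfolding J'_def by auto
      \<comment> \<open>The trace of \<open>z\<close> contains all others, so that each trace on \<open>P'\<close> is a trace on \<open>N z\<close>.\<close>
      have "N a \<inter> P' = (N a \<inter> N z) \<inter> P'" if "a \<in> J" for a
        using top that unfolding P'_def by auto
      then have "laminar J (\<lambda>a. N a \<inter> P') = laminar J (\<lambda>a. (N a \<inter> N z) \<inter> P')"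
        by (rule laminar_cong)
      then have lam': "laminar J (\<lambda>a. N a \<inter> P')"
        using laminar_Int[OF tri[OF z(1)], of P'] by simp
      obtain pos \<rho> where IH: "\<forall>a\<in>J'. pos a < card J'" "refines N B P' J' \<rho>"
        "\<forall>u\<in>U - N z. J' = {} \<or> window N B J' pos \<rho> u"
      proof -
        \<comment> \<open>Only the elements outside \<open>N z\<close> are left to be processed: the others join \<open>P\<close>.\<close>
        have "\<exists>pos \<rho>. (\<forall>a\<in>J'. pos a < card J') \<and> refines N B P' J' \<rho> \<and>
          (\<forall>u\<in>U - N z. J' = {} \<or> window N B J' pos \<rho> u)"
        proof (rule less.hyps)
          show "card J' < card J" "finite J'" "finite (U - N z)" "finite P'" "B \<subseteq> P'"
            using card fin BP sub finite_subset unfolding P'_def by auto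
          show "laminar J' (\<lambda>a. N a \<inter> P')" using lam' sub laminar_subset by blast
          show "laminar J' (\<lambda>a. N a \<inter> N y)" if "y \<in> J'" for y
            using tri sub laminar_subset that by blast
          show "N a \<inter> B \<noteq> {}" if "a \<in> J'" for a using ne sub that by blast
          show "N a \<inter> (U - N z) \<subseteq> N b \<or> N b \<inter> (U - N z) \<subseteq> N a"
            if "a \<in> J'" "b \<in> J'" "N a \<inter> N b \<inter> B = {}" for a b
            using cmp[of a b] sub that by blast
        qed
        then show ?thesis using that by blast
      qed
      obtain R where R: "\<forall>a\<in>J'. \<rho> a < R"
        using fin(1) sub finite_subset
        by (metis finite_imageI finite_nat_set_iff_bounded imageI)
      \<comment> \<open>The element \<open>z\<close> comes first, so it lies before the windows of all elements outside \<open>N z\<close>. Its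
        trace is the largest, so its rank has to be above all others.\<close>
      define pos' where "pos' = (\<lambda>a. if a = z then 0 else Suc (pos a))"
      define \<rho>' where "\<rho>' = \<rho>(z := R)"
      have pos': "\<forall>a\<in>J. pos' a < card J"
        using IH(1) card unfolding pos'_def J'_def by auto
      have ref: "\<rho>' a < \<rho>' b"
        if ab: "a \<in> J" "b \<in> J" "N a \<inter> B = N b \<inter> B" "N a \<inter> P' \<subset> N b \<inter> P'" for a b
      proof -
        have "a \<noteq> z" using that top unfolding P'_def by blast
        then show ?thesis using that IH(2) R unfolding \<rho>'_def J'_def refines_def by auto
      qed
      have "refines N B P J \<rho>'"
        unfolding refines_def
      proof (intro ballI impI)
        fix a b assume ab: "a \<in> J" "b \<in> J" "N a \<inter> B = N b \<inter> B" "N a \<inter> P \<subset> N b \<inter> P"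
        then have "N a \<inter> N b \<inter> P \<noteq> {}" using ne BP by blast
        then have "N a \<inter> P' \<subseteq> N b \<inter> P' \<or> N b \<inter> P' \<subseteq> N a \<inter> P'"
          using lam' ab(1,2) unfolding laminar_def P'_def by blast
        then have "N a \<inter> P' \<subset> N b \<inter> P'" using ab(4) unfolding P'_def by blast
        then show "\<rho>' a < \<rho>' b" using ref ab by blast
      qed
      moreover have "window N B J pos' \<rho>' u" if u: "u \<in> U" for u
      proof (cases "u \<in> N z")
        case True
        \<comment> \<open>All neighbours of \<open>u\<close> in \<open>J\<close> meet in \<open>u \<in> P'\<close>, so their traces are a chain; \<open>a0\<close> is the least
          of them in the order by the trace on \<open>B\<close> and then by rank.\<close>
        define X where "X = {a\<in>J. u \<in> N a}"
        have X: "finite X" "X \<noteq> {}" using True z(1) fin(1) unfolding X_def by auto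
        define m where "m = Min ((\<lambda>a. card (N a \<inter> B)) ` X)"
        define Y where "Y = {a\<in>X. card (N a \<inter> B) = m}"
        have "m \<in> (\<lambda>a. card (N a \<inter> B)) ` X" unfolding m_def using X by (intro Min_in) auto
        then have Y: "finite Y" "Y \<noteq> {}" using X unfolding Y_def by auto
        obtain a0 where a0: "a0 \<in> Y" "\<And>a. a \<in> Y \<Longrightarrow> \<rho>' a0 \<le> \<rho>' a"
          using finite_argmin[OF Y, of \<rho>'] by blast
        have a0X: "a0 \<in> X" "card (N a0 \<inter> B) = m" and a0J: "a0 \<in> J" "u \<in> N a0"
          using a0(1) unfolding Y_def X_def by auto
        have finB: "finite B" using fin(3) BP finite_subset by blast
        have uP: "u \<in> P'" using True u unfolding P'_def by blast
        have "u \<in> N a \<longleftrightarrow> above (\<lambda>a. N a \<inter> B) \<rho>' a0 a" if a: "a \<in> J" for a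
        proof
          assume ua: "u \<in> N a"
          then have aX: "a \<in> X" using a unfolding X_def by blast
          then have le: "card (N a0 \<inter> B) \<le> card (N a \<inter> B)"
            unfolding a0X(2) m_def using X by (intro Min_le) auto
          have "N a0 \<inter> P' \<subseteq> N a \<inter> P' \<or> N a \<inter> P' \<subseteq> N a0 \<inter> P'"
            using lam' a a0J ua uP unfolding laminar_def by blast
          then have "N a0 \<inter> B \<subseteq> N a \<inter> B \<or> N a \<inter> B \<subseteq> N a0 \<inter> B"
            using BP unfolding P'_def by blast
          then have "N a0 \<inter> B \<subseteq> N a \<inter> B"
            using card_seteq[of "N a0 \<inter> B" "N a \<inter> B"] le finB by auto
          moreover have "\<rho>' a0 \<le> \<rho>' a" if "N a0 \<inter> B = N a \<inter> B"
            using a0(2)[of a] aX a0X(2) that unfolding Y_def by auto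
          ultimately show "above (\<lambda>a. N a \<inter> B) \<rho>' a0 a" unfolding above_def by blast
        next
          assume ab: "above (\<lambda>a. N a \<inter> B) \<rho>' a0 a"
          have "N a0 \<inter> N a \<inter> B \<noteq> {}" using ab ne[OF a0J(1)] unfolding above_def by blast
          then have "N a0 \<inter> P' \<subseteq> N a \<inter> P' \<or> N a \<inter> P' \<subseteq> N a0 \<inter> P'"
            using lam' a a0J(1) BP unfolding laminar_def P'_def by blast
          moreover have False if s: "N a \<inter> P' \<subset> N a0 \<inter> P'"
          proof -
            have "N a \<inter> B = N a0 \<inter> B" using s ab BP unfolding above_def P'_def by blast
            then show False using ref[OF a a0J(1) _ s] ab unfolding above_def by auto
          qed
          ultimately have "N a0 \<inter> P' \<subseteq> N a \<inter> P'" by blast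
          then show "u \<in> N a" using uP a0J by blast
        qed
        then show ?thesis using a0J pos' unfolding window_def
          by (intro exI[of _ 0] exI[of _ "card J"] bexI[of _ a0]) (auto simp: not_le[symmetric])
      next
        case False
        show ?thesis
        proof (cases "J' = {}")
          case True
          then have "J = {z}" using z unfolding J'_def by auto
          \<comment> \<open>Nothing is left in \<open>J'\<close>; an empty window at the end expresses that \<open>u\<close> has no neighbour.\<close>
          then show ?thesis using False unfolding window_def pos'_def
            by (intro exI[of _ 1] bexI[of _ z]) auto
        next
          case J': False
          then obtain l h a0 where w: "a0 \<in> J'" "l \<le> h" "h \<le> card J'"
            "\<forall>a\<in>J'. u \<in> N a \<longleftrightarrow> h \<le> pos a \<or> l \<le> pos a \<and> above (\<lambda>a. N a \<inter> B) \<rho> a0 a"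
            using IH(3) False u unfolding window_def by blast
          have "above (\<lambda>a. N a \<inter> B) \<rho>' a0 a = above (\<lambda>a. N a \<inter> B) \<rho> a0 a" if "a \<in> J'" for a
            using that w(1) unfolding above_def \<rho>'_def J'_def by auto
          then have "\<forall>a\<in>J. u \<in> N a \<longleftrightarrow> Suc h \<le> pos' a \<or>
              Suc l \<le> pos' a \<and> above (\<lambda>a. N a \<inter> B) \<rho>' a0 a"
            using w(4) False unfolding pos'_def J'_def by auto
          then show ?thesis using w(1-3) card sub unfolding window_def
            by (intro exI[of _ "Suc l"] exI[of _ "Suc h"] bexI[of _ a0]) auto
        qed
      qed
      ultimately show ?thesis using pos' by blast
    next
      case False
      define K where "K = {a\<in>J. N a \<inter> P \<subseteq> N z}"
      have K: "K \<subseteq> J" "K \<noteq> {}" "K \<noteq> J" using False z(1) unfolding K_def by auto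
      have "N a \<inter> U \<subseteq> N b \<or> N b \<inter> U \<subseteq> N a" if ab: "a \<in> K" "b \<in> J - K" for a b
      proof -
        \<comment> \<open>Were the traces of \<open>z\<close> and \<open>b\<close> to meet, they would be nested and, by the choice of \<open>z\<close>, the
          trace of \<open>b\<close> would lie inside that of \<open>z\<close>.\<close>
        have "N z \<inter> P \<inter> (N b \<inter> P) = {}"
        proof (rule ccontr)
          assume "N z \<inter> P \<inter> (N b \<inter> P) \<noteq> {}"
          then have "N z \<inter> P \<subseteq> N b \<inter> P"
            using lam z(1) ab unfolding laminar_def K_def by blast
          then have "N z \<inter> P = N b \<inter> P"
            using z(2)[of b] ab fin(3) by (intro card_seteq) auto
          then show False using ab unfolding K_def by auto
        qed
        then have "N a \<inter> N b \<inter> B = {}" using ab(1) BP unfolding K_def by blast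
        then show ?thesis using cmp[of a b] ab K by auto
      qed
      then obtain J1 where J1: "J1 \<subseteq> J" "J1 \<noteq> {}" "J1 \<noteq> J"
        and split: "\<forall>a\<in>J1. \<forall>b\<in>J - J1. N a \<inter> U \<subseteq> N b"
        using cross_comparable_split[OF fin(1,2) K] by metis
      define J2 where "J2 = J - J1"
      have J2: "J2 \<subseteq> J" "J2 \<noteq> {}" using J1 unfolding J2_def by auto
      have f12: "finite J1" "finite J2" using J1(1) J2(1) fin(1) finite_subset by auto
      have "J = J1 \<union> J2" "J1 \<inter> J2 = {}" using J1 unfolding J2_def by auto
      then have card: "card J = card J1 + card J2" using f12 by (simp add: card_Un_disjoint)
      have "card J1 > 0" "card J2 > 0" using f12 J1(2) J2(2) by (simp_all add: card_gt_0_iff)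
      then have lt: "card J1 < card J" "card J2 < card J" using card by auto
      have IH: "\<exists>pos \<rho>. (\<forall>a\<in>I. pos a < card I) \<and> refines N B P I \<rho> \<and>
          (\<forall>u\<in>U. I = {} \<or> window N B I pos \<rho> u)"
        if I: "I \<subseteq> J" "card I < card J" for I
      proof (rule less.hyps)
        show "finite I" using I(1) fin(1) finite_subset by blast
        show "laminar I (\<lambda>a. N a \<inter> P)" using lam I laminar_subset by blast
        show "laminar I (\<lambda>a. N a \<inter> N y)" if "y \<in> I" for y
          using tri I laminar_subset that by blast
        show "N a \<inter> B \<noteq> {}" if "a \<in> I" for a using ne I that by blast
        show "N a \<inter> U \<subseteq> N b \<or> N b \<inter> U \<subseteq> N a"
          if "a \<in> I" "b \<in> I" "N a \<inter> N b \<inter> B = {}" for a b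
          using cmp[of a b] I that by blast
      qed (use I fin BP in auto)
      obtain p1 r1 where 1: "\<forall>a\<in>J1. p1 a < card J1" "refines N B P J1 r1"
          "\<forall>u\<in>U. window N B J1 p1 r1 u"
        using IH[OF J1(1) lt(1)] J1(2) by blast
      obtain p2 r2 where 2: "\<forall>a\<in>J2. p2 a < card J2" "refines N B P J2 r2"
          "\<forall>u\<in>U. window N B J2 p2 r2 u"
        using IH[OF J2(1) lt(2)] J2(2) by blast
      define pos where "pos a = (if a \<in> J1 then p1 a else card J1 + p2 a)" for a
      define r where "r a = (if a \<in> J1 then r1 a else r2 a)" for a
      obtain R where R: "\<forall>a\<in>J. r a < R"
        using fin(1) by (metis finite_imageI finite_nat_set_iff_bounded imageI)
      \<comment> \<open>The ranks of the two parts have to be merged into one that follows the chains of traces also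
        between \<open>J1\<close> and \<open>J2\<close>. The size of the trace comes first and the old rank second; inside
        each part this keeps the order of the elements that have the same trace on \<open>B\<close>.\<close>
      define \<rho> where "\<rho> a = card (N a \<inter> P) * R + r a" for a
      have key: "\<rho> a < \<rho> b" if "a \<in> J" "b \<in> J" "card (N a \<inter> P) < card (N b \<inter> P)" for a b
      proof -
        have "\<rho> a < Suc (card (N a \<inter> P)) * R" using R that(1) unfolding \<rho>_def by auto
        also have "\<dots> \<le> card (N b \<inter> P) * R" using that(3) by (intro mult_right_mono) auto
        finally show ?thesis unfolding \<rho>_def by linarith
      qed
      have ref: "refines N B P J \<rho>"
        unfolding refines_def using key fin(3) by (auto intro: psubset_card_mono)
      have le: "\<rho> a \<le> \<rho> b \<longleftrightarrow> r a \<le> r b"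
        if ab: "a \<in> I" "b \<in> I" "N a \<inter> B = N b \<inter> B" and I: "I \<subseteq> J" "refines N B P I r"
        for a b I
      proof -
        have aJ: "a \<in> J" "b \<in> J" using that by auto
        have "N a \<inter> N b \<inter> B \<noteq> {}" using ab(3) ne[OF aJ(1)] by blast
        then have "N a \<inter> P \<subseteq> N b \<inter> P \<or> N b \<inter> P \<subseteq> N a \<inter> P"
          using lam aJ BP unfolding laminar_def by blast
        then consider "N a \<inter> P = N b \<inter> P" | "N a \<inter> P \<subset> N b \<inter> P" | "N b \<inter> P \<subset> N a \<inter> P"
          by blast
        then show ?thesis
        proof cases
          case 1
          then show ?thesis unfolding \<rho>_def by simp
        next
          case 2
          then have "r a < r b" "\<rho> a < \<rho> b" using that ref aJ unfolding refines_def by blast+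
          then show ?thesis by simp
        next
          case 3
          then have "r b < r a" "\<rho> b < \<rho> a" using that ref aJ unfolding refines_def by metis+
          then show ?thesis by simp
        qed
      qed
      have ref1: "refines N B P J1 r" and ref2: "refines N B P J2 r"
        using 1(2) 2(2) unfolding refines_def r_def J2_def by auto
      have ab1: "above (\<lambda>a. N a \<inter> B) \<rho> a0 a = above (\<lambda>a. N a \<inter> B) r1 a0 a"
        if "a0 \<in> J1" "a \<in> J1" for a0 a
        using le[OF that _ J1(1) ref1] that unfolding above_def r_def by auto
      have ab2: "above (\<lambda>a. N a \<inter> B) \<rho> a0 a = above (\<lambda>a. N a \<inter> B) r2 a0 a"
        if "a0 \<in> J2" "a \<in> J2" for a0 a
        using le[OF that _ J2(1) ref2] that unfolding above_def r_def J2_def by auto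
      have pos: "\<forall>a\<in>J. pos a < card J"
        using 1(1) 2(1) card unfolding pos_def J2_def by fastforce
      have "window N B J pos \<rho> u" if u: "u \<in> U" for u
      proof (cases "\<forall>b\<in>J2. u \<in> N b")
        case True
        obtain l h a0 where w: "a0 \<in> J1" "l \<le> h" "h \<le> card J1"
          "\<forall>a\<in>J1. u \<in> N a \<longleftrightarrow> h \<le> p1 a \<or> l \<le> p1 a \<and> above (\<lambda>a. N a \<inter> B) r1 a0 a"
          using 1(3) u unfolding window_def by blast
        have "\<forall>a\<in>J. u \<in> N a \<longleftrightarrow> h \<le> pos a \<or> l \<le> pos a \<and> above (\<lambda>a. N a \<inter> B) \<rho> a0 a"
          using w True ab1[OF w(1)] unfolding pos_def J2_def by auto
        then show ?thesis using w(1-3) card J1(1) unfolding window_def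
          by (intro exI[of _ l] exI[of _ h] bexI[of _ a0]) auto
      next
        case False
        \<comment> \<open>As \<open>u\<close> misses some \<open>b \<in> J2\<close>, it misses all of \<open>J1\<close>, whose sets lie below that of \<open>b\<close>.\<close>
        then have no: "\<forall>a\<in>J1. u \<notin> N a" using split u unfolding J2_def by blast
        obtain l h a0 where w: "a0 \<in> J2" "l \<le> h" "h \<le> card J2"
          "\<forall>a\<in>J2. u \<in> N a \<longleftrightarrow> h \<le> p2 a \<or> l \<le> p2 a \<and> above (\<lambda>a. N a \<inter> B) r2 a0 a"
          using 2(3) u unfolding window_def by blast
        have "u \<in> N a \<longleftrightarrow> card J1 + h \<le> pos a \<or>
            card J1 + l \<le> pos a \<and> above (\<lambda>a. N a \<inter> B) \<rho> a0 a" if "a \<in> J" for a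
        proof (cases "a \<in> J1")
          case True
          then show ?thesis using no 1(1) w(2) unfolding pos_def by force
        next
          case False
          then have "a \<in> J2" using that unfolding J2_def by blast
          then show ?thesis using False w(4) ab2[OF w(1)] unfolding pos_def by auto
        qed
        then show ?thesis using w(1-3) card J2(1) unfolding window_def
          by (intro exI[of _ "card J1 + l"] exI[of _ "card J1 + h"] bexI[of _ a0]) auto
      qed
      then show ?thesis using pos ref by blast
    qed
  qed
qed

section \<open>Labels that determine the edges\<close>

text \<open>
  \<open>Root\<close> is the chosen vertex \<open>x\<close> of the component and \<open>Layer\<close> the distance from it. In layer 1,
  \<open>Pos\<close> is the place in the interval order. In layer 2, \<open>Lo\<close> and \<open>Hi\<close> delimit the interval of
  neighbours in layer 1, while \<open>Pos\<close> and \<open>Rank\<close> are the two orders used by the windows of layer 3.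
  In layer 3, \<open>Lo\<close> and \<open>Hi\<close> delimit the window and \<open>Ptr\<close> is the least neighbour in it.
\<close>

datatype field = Root | Layer | Pos | Lo | Hi | Rank | Ptr

text \<open>
  The edges from layer 1 to layer 2 (\<open>inner\<close>), from layer 2 to layer 3 (\<open>outer\<close>), and all edges,
  directed away from the root (\<open>arc\<close>), as they are read off from the labels.
\<close>

definition inner :: "('v \<Rightarrow> field \<Rightarrow> nat) \<Rightarrow> 'v \<Rightarrow> 'v \<Rightarrow> bool" where
  "inner f b a \<longleftrightarrow> f b Root = f a Root \<and> f b Layer = 1 \<and> f a Layer = 2 \<and>
    f a Lo \<le> f b Pos \<and> f b Pos < f a Hi"

definition outer :: "nat set \<Rightarrow> (nat \<Rightarrow> field \<Rightarrow> nat) \<Rightarrow> nat \<Rightarrow> nat \<Rightarrow> bool" where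
  "outer W f a u \<longleftrightarrow> f a Root = f u Root \<and> f a Layer = 2 \<and> f u Layer = 3 \<and>
    (f u Hi \<le> f a Pos \<or> f u Lo \<le> f a Pos \<and>
      above (\<lambda>a. {b\<in>W. inner f b a}) (\<lambda>a. f a Rank) (f u Ptr) a)"

definition arc :: "nat set \<Rightarrow> (nat \<Rightarrow> field \<Rightarrow> nat) \<Rightarrow> nat \<Rightarrow> nat \<Rightarrow> bool" where
  "arc W f u v \<longleftrightarrow> f u Root = f v Root \<and> f u Layer = 0 \<and> f v Layer = 1 \<or>
    inner f u v \<or> outer W f u v"

text \<open>
  Demanding that \<open>Root\<close> and \<open>Ptr\<close> stay inside \<open>W\<close> is what makes labellings of different components
  compatible.
\<close>

definition labels :: "nat set \<Rightarrow> nat \<Rightarrow> (nat \<Rightarrow> nat \<Rightarrow> bool) \<Rightarrow> (nat \<Rightarrow> field \<Rightarrow> nat) \<Rightarrow> bool" where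
  "labels W m adj f \<longleftrightarrow>
    (\<forall>v\<in>W. f v Root \<in> W \<and> f v Ptr \<in> W \<and> (\<forall>k. f v k \<in> W \<or> f v k \<le> m)) \<and>
    (\<forall>u\<in>W. \<forall>v\<in>W. adj u v \<longleftrightarrow> arc W f u v \<or> arc W f v u)"

text \<open>
  The roots of the two labellings lie in different sets, so no arc is created between the sets and
  the set comparisons in \<open>outer\<close> do not change.
\<close>

lemma labels_Un:
  assumes f: "labels K m adj f" and g: "labels W m adj g" and disj: "K \<inter> W = {}"
    and none: "\<And>u v. u \<in> K \<Longrightarrow> v \<in> W \<Longrightarrow> \<not> adj u v \<and> \<not> adj v u"
  shows "labels (K \<union> W) m adj (\<lambda>v. if v \<in> K then f v else g v)" (is "labels _ _ _ ?h")
proof -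
  have rK: "f v Root \<in> K" "f v Ptr \<in> K" if "v \<in> K" for v
    using f that unfolding labels_def by auto
  have rW: "g v Root \<in> W" "g v Ptr \<in> W" if "v \<in> W" for v
    using g that unfolding labels_def by auto
  have iK: "{b \<in> K \<union> W. inner ?h b a} = {b \<in> K. inner f b a}" if "a \<in> K" for a
    using that rK rW disj unfolding inner_def by auto (metis disjoint_iff)+
  have iW: "{b \<in> K \<union> W. inner ?h b a} = {b \<in> W. inner g b a}" if "a \<in> W" for a
    using that rK rW disj unfolding inner_def by auto (metis disjoint_iff)+
  have aK: "arc (K \<union> W) ?h u v = arc K f u v" if uv: "u \<in> K" "v \<in> K" for u v
  proof -
    have "outer (K \<union> W) ?h u v = outer K f u v"
      using uv rK(2)[OF uv(2)] unfolding outer_def above_def by (simp add: iK del: Un_iff)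
    then show ?thesis using uv unfolding arc_def inner_def by auto
  qed
  have aW: "arc (K \<union> W) ?h u v = arc W g u v" if uv: "u \<in> W" "v \<in> W" for u v
  proof -
    have nK: "u \<notin> K" "v \<notin> K" "g v Ptr \<notin> K" using uv rW(2) disj by auto
    have "outer (K \<union> W) ?h u v = outer W g u v"
      using uv rW(2)[OF uv(2)] nK unfolding outer_def above_def by (simp add: iW del: Un_iff)
    then show ?thesis using uv nK unfolding arc_def inner_def by auto
  qed
  have aN: "\<not> arc (K \<union> W) ?h u v" if "u \<in> K \<and> v \<in> W \<or> u \<in> W \<and> v \<in> K" for u v
  proof -
    have "?h u Root \<noteq> ?h v Root" using that rK(1) rW(1) disj by (metis disjoint_iff)
    then show ?thesis unfolding arc_def inner_def outer_def by blast
  qed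
  have "adj u v \<longleftrightarrow> arc (K \<union> W) ?h u v \<or> arc (K \<union> W) ?h v u"
    if uv: "u \<in> K \<union> W" "v \<in> K \<union> W" for u v
  proof -
    consider "u \<in> K" "v \<in> K" | "u \<in> W" "v \<in> W" | "u \<in> K" "v \<in> W" | "u \<in> W" "v \<in> K"
      using uv by blast
    then show ?thesis
    proof cases
      case 1
      then show ?thesis using f aK unfolding labels_def by blast
    next
      case 2
      then show ?thesis using g aW unfolding labels_def by blast
    qed (use none aN in blast)+
  qed
  moreover have "?h v Root \<in> K \<union> W \<and> ?h v Ptr \<in> K \<union> W \<and> (\<forall>k. ?h v k \<in> K \<union> W \<or> ?h v k \<le> m)"
    if "v \<in> K \<union> W" for v
    using f g that unfolding labels_def by auto
  ultimately show ?thesis unfolding labels_def by blast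
qed

section \<open>The distance layers\<close>

text \<open>
  Vertices with the same colour are never adjacent, so \<open>P\<^sub>7\<close> and the domino are excluded by naming
  only the missing edges between the colour classes. The vertices in these patterns are then
  automatically distinct: two that have the same colour are separated by some adjacency.
\<close>

locale P7_domino_free_bigraph =
  fixes V :: "nat set" and adj :: "nat \<Rightarrow> nat \<Rightarrow> bool" and col :: "nat \<Rightarrow> bool"
  assumes finV: "finite V"
    and adjV: "adj u v \<Longrightarrow> u \<in> V \<and> v \<in> V"
    and adj_sym: "adj u v \<Longrightarrow> adj v u"
    and adj_col: "adj u v \<Longrightarrow> col u \<noteq> col v"
    and P7_free: "\<lbrakk>adj x1 x2; adj x2 x3; adj x3 x4; adj x4 x5; adj x5 x6; adj x6 x7;
      \<not> adj x1 x4; \<not> adj x1 x6; \<not> adj x2 x5; \<not> adj x2 x7; \<not> adj x3 x6; \<not> adj x4 x7\<rbrakk> \<Longrightarrow> False"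
    and domino_free: "\<lbrakk>adj x1 y1; adj x1 y2; adj x2 y1; adj x2 y2; adj x2 y3; adj x3 y2; adj x3 y3;
      \<not> adj x1 y3; \<not> adj x3 y1\<rbrakk> \<Longrightarrow> False"
begin

definition nbh :: "nat \<Rightarrow> nat set" where
  "nbh v = {u. adj v u}"

definition nbh2 :: "nat \<Rightarrow> nat set" where
  "nbh2 v = {s. \<exists>b. adj v b \<and> adj b s}"

lemma finite_nbh: "finite (nbh v)" "finite (nbh2 v)"
  using finV adjV unfolding nbh_def nbh2_def by (auto elim: rev_finite_subset)

text \<open>
  Two traces on \<open>N(z)\<close> that meet in \<open>y\<^sub>2\<close> and are not nested form a domino together with \<open>z\<close>, in
  which the edge \<open>z y\<^sub>2\<close> is the chord.
\<close>

lemma laminar_nbh: "laminar I (\<lambda>a. nbh a \<inter> nbh z)"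
proof -
  have "nbh a \<inter> nbh z \<inter> (nbh b \<inter> nbh z) = {} \<or> nbh a \<inter> nbh z \<subseteq> nbh b \<inter> nbh z
      \<or> nbh b \<inter> nbh z \<subseteq> nbh a \<inter> nbh z" for a b
    using domino_free[of a _ _ z _ b] unfolding nbh_def by blast
  then show ?thesis unfolding laminar_def by blast
qed

text \<open>
  The component is that of a vertex \<open>x\<close> with the most vertices at distance 2. The two uses
  of \<open>P\<^sub>7\<close>-freeness are that there is no fourth layer, and that vertices of the second layer without
  a common neighbour in the first layer have comparable neighbourhoods in the third.
\<close>

lemma labels_one_component:
  assumes W: "W \<subseteq> V" "W \<noteq> {}" and closed: "\<forall>u\<in>W. \<forall>v. adj u v \<longrightarrow> v \<in> W"
  shows "\<exists>K f. K \<subseteq> W \<and> K \<noteq> {} \<and> (\<forall>u\<in>K. \<forall>v. adj u v \<longrightarrow> v \<in> K) \<and> labels K (card V + 3) adj f"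
proof -
  have "finite W" using W finV finite_subset by blast
  then obtain x where x: "x \<in> W" and xmax: "\<And>a. a \<in> W \<Longrightarrow> card (nbh2 a) \<le> card (nbh2 x)"
    using finite_argmax[of W "\<lambda>a. card (nbh2 a)"] W by blast
  define L1 where "L1 = nbh x"
  define L2 where "L2 = nbh2 x - {x}"
  define L3 where "L3 = {c. \<exists>a\<in>L2. adj a c} - L1"
  define K where "K = {x} \<union> L1 \<union> L2 \<union> L3"
  have L1: "b \<in> L1 \<longleftrightarrow> adj x b" for b unfolding L1_def nbh_def by simp
  have L1W: "L1 \<subseteq> W" using x closed L1 by blast
  have L2W: "L2 \<subseteq> W" using x closed unfolding L2_def nbh2_def by blast
  have L3W: "L3 \<subseteq> W" using L2W closed unfolding L3_def by blast
  have KW: "K \<subseteq> W" using x L1W L2W L3W unfolding K_def by blast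
  have cols: "v \<in> L1 \<Longrightarrow> col v \<noteq> col x" "v \<in> L2 \<Longrightarrow> col v = col x" "v \<in> L3 \<Longrightarrow> col v \<noteq> col x" for v
    using adj_col L1 unfolding L2_def L3_def nbh2_def by blast+
  have disj: "x \<notin> L1" "x \<notin> L2" "x \<notin> L3" "L1 \<inter> L2 = {}" "L1 \<inter> L3 = {}" "L2 \<inter> L3 = {}"
    using cols unfolding L2_def L3_def by blast+
  have from1: "s \<in> L2 \<or> s = x" if "b \<in> L1" "adj b s" for b s
    using that L1 unfolding L2_def nbh2_def by blast
  have to1: "\<exists>b. b \<in> L1 \<and> adj a b" if "a \<in> L2" for a
    using that L1 adj_sym unfolding L2_def nbh2_def by blast
  have from2: "c \<in> L1 \<or> c \<in> L3" if "a \<in> L2" "adj a c" for a c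
    using that unfolding L3_def by blast
  have from3: "d \<in> L2" if c: "c \<in> L3" and cd: "adj c d" for c d
  proof (rule ccontr)
    \<comment> \<open>Otherwise \<open>d\<close> is at distance 4 from \<open>x\<close>, along a path \<open>x b a c d\<close>. As \<open>a\<close> reaches \<open>d\<close> in two
      steps and \<open>x\<close> does not, the choice of \<open>x\<close> gives some \<open>s\<close> that \<open>x\<close> reaches in two steps, via
      \<open>b'\<close>, and \<open>a\<close> does not. Then \<open>d c a b x b' s\<close> is an induced path.\<close>
    assume d: "d \<notin> L2"
    have cx: "\<not> adj c x" using c L1 adj_sym disj(5) by blast
    have dn: "d \<notin> nbh2 x" using d cd cx unfolding L2_def by blast
    obtain a where a: "a \<in> L2" "adj a c" using c unfolding L3_def by blast
    obtain b where b: "b \<in> L1" "adj a b" using to1 a by blast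
    have da: "d \<in> nbh2 a" using a cd unfolding nbh2_def by blast
    have "card (nbh2 a) \<le> card (nbh2 x)" using xmax a(1) L2W by blast
    then have "\<not> nbh2 x \<subset> nbh2 a"
      using psubset_card_mono[OF finite_nbh(2), of "nbh2 x" a] by linarith
    then obtain s where s: "s \<in> nbh2 x" "s \<notin> nbh2 a"
      using da dn by blast
    obtain b' where b': "adj x b'" "adj b' s" using s(1) unfolding nbh2_def by blast
    have "\<not> adj d b" "\<not> adj d b'" using dn b(1) L1 b'(1) adj_sym unfolding nbh2_def by blast+
    moreover have "\<not> adj c s" "\<not> adj a b'" "\<not> adj b s"
      using s(2) a(2) b'(2) b(2) unfolding nbh2_def by blast+
    ultimately show False
      using P7_free[of d c a b x b' s] cd a(2) b b' L1 cx adj_sym by blast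
  qed
  have edges: "adj u v \<longleftrightarrow> (u = x \<and> v \<in> L1 \<or> u \<in> L1 \<and> v \<in> L2 \<and> adj u v \<or> u \<in> L2 \<and> v \<in> L3 \<and> adj u v)
      \<or> (v = x \<and> u \<in> L1 \<or> v \<in> L1 \<and> u \<in> L2 \<and> adj v u \<or> v \<in> L2 \<and> u \<in> L3 \<and> adj v u)"
    if "u \<in> K" "v \<in> K" for u v
    using that L1[of u] L1[of v] from1[of u v] from2[of u v] from3[of u v] adj_sym[of u v] adj_sym[of v u]
    unfolding K_def by blast
  have closedK: "\<forall>u\<in>K. \<forall>v. adj u v \<longrightarrow> v \<in> K"
    using L1 from1 from2 from3 unfolding K_def by blast
  have fin: "finite L1" "finite L2" "finite L3"
    using finite_subset[OF L1W] finite_subset[OF L2W] finite_subset[OF L3W] \<open>finite W\<close>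
    by simp_all
  have cardV: "card L1 \<le> card V" "card L2 \<le> card V"
    using L1W L2W W finV by (auto intro!: card_mono)
  have "laminar ((\<lambda>a. nbh a \<inter> L1) ` L2) (\<lambda>X. X)"
    using laminar_nbh[of L2 x] unfolding laminar_def L1_def by blast
  then obtain p where p: "\<forall>b\<in>L1. p b < card L1"
    "\<forall>X\<in>(\<lambda>a. nbh a \<inter> L1) ` L2. \<exists>l h. l \<le> h \<and> h \<le> card L1 \<and>
      (\<forall>b\<in>L1. b \<in> X \<longleftrightarrow> l \<le> p b \<and> p b < h)"
    using laminar_interval_order[OF fin(1), of "(\<lambda>a. nbh a \<inter> L1) ` L2"] by blast
  have "\<exists>l h. l \<le> h \<and> h \<le> card L1 \<and> (\<forall>b\<in>L1. b \<in> nbh a \<longleftrightarrow> l \<le> p b \<and> p b < h)"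
    if "a \<in> L2" for a
    using bspec[OF p(2) imageI[OF that]] by simp
  then obtain lo hi where int: "\<And>a. a \<in> L2 \<Longrightarrow> lo a \<le> hi a \<and> hi a \<le> card L1 \<and>
      (\<forall>b\<in>L1. b \<in> nbh a \<longleftrightarrow> lo a \<le> p b \<and> p b < hi a)"
    by metis
  have cmp: "nbh a \<inter> L3 \<subseteq> nbh a' \<or> nbh a' \<inter> L3 \<subseteq> nbh a"
    if a: "a \<in> L2" "a' \<in> L2" "nbh a \<inter> nbh a' \<inter> L1 = {}" for a a'
  proof (rule ccontr)
    assume "\<not> ?thesis"
    then obtain c c' where c: "adj a c" "\<not> adj a' c" "c \<in> L3" "adj a' c'" "\<not> adj a c'" "c' \<in> L3"
      unfolding nbh_def by blast
    obtain b b' where b: "b \<in> L1" "adj a b" "b' \<in> L1" "adj a' b'" using to1 a by blast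
    have "\<not> adj a b'" "\<not> adj a' b" using a(3) b unfolding nbh_def by blast+
    moreover have "\<not> adj x c" "\<not> adj x c'" using c L1 disj(5) by blast+
    \<comment> \<open>The induced path leads from \<open>c\<close> down to \<open>x\<close> and up again to \<open>c'\<close>.\<close>
    ultimately show False using P7_free[of c a b x b' a' c'] c b L1 adj_sym by blast
  qed
  obtain pos \<rho> where pos: "\<forall>a\<in>L2. pos a < card L2"
    and win: "\<forall>u\<in>L3. L2 = {} \<or> window nbh L1 L2 pos \<rho> u"
  proof -
    have "\<exists>pos \<rho>. (\<forall>a\<in>L2. pos a < card L2) \<and> refines nbh L1 L1 L2 \<rho> \<and>
        (\<forall>u\<in>L3. L2 = {} \<or> window nbh L1 L2 pos \<rho> u)"
    proof (rule windows_exist[OF fin(2,3,1) order_refl])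
      show "laminar L2 (\<lambda>a. nbh a \<inter> L1)" using laminar_nbh unfolding L1_def .
      show "nbh a \<inter> L1 \<noteq> {}" if "a \<in> L2" for a using to1[OF that] unfolding nbh_def by blast
    qed (use laminar_nbh cmp in auto)
    then show ?thesis using that by blast
  qed
  have "L2 \<noteq> {}" if "u \<in> L3" for u using that unfolding L3_def by blast
  then have "\<forall>u\<in>L3. \<exists>l h a0. a0 \<in> L2 \<and> l \<le> h \<and> h \<le> card L2 \<and>
    (\<forall>a\<in>L2. u \<in> nbh a \<longleftrightarrow> h \<le> pos a \<or> l \<le> pos a \<and> above (\<lambda>a. nbh a \<inter> L1) \<rho> a0 a)"
    using win unfolding window_def by blast
  then obtain l h a0 where w: "\<And>u. u \<in> L3 \<Longrightarrow> a0 u \<in> L2 \<and> l u \<le> h u \<and> h u \<le> card L2 \<and>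
    (\<forall>a\<in>L2. u \<in> nbh a \<longleftrightarrow> h u \<le> pos a \<or> l u \<le> pos a \<and> above (\<lambda>a. nbh a \<inter> L1) \<rho> (a0 u) a)"
    by metis
  \<comment> \<open>The values of \<open>\<rho>\<close> may be large. Only their order matters, so they are replaced by numbers of
    predecessors.\<close>
  define rank where "rank a = card {a'\<in>L2. \<rho> a' < \<rho> a}" for a
  have rank: "rank a \<le> card L2" for a
    unfolding rank_def using fin(2) by (intro card_mono) auto
  have rank_le: "rank a \<le> rank a' \<longleftrightarrow> \<rho> a \<le> \<rho> a'" if "a \<in> L2" "a' \<in> L2" for a a'
  proof
    assume "\<rho> a \<le> \<rho> a'"
    then show "rank a \<le> rank a'" unfolding rank_def using fin(2) by (intro card_mono) auto
  next
    assume le: "rank a \<le> rank a'"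
    show "\<rho> a \<le> \<rho> a'"
    proof (rule ccontr)
      assume "\<not> \<rho> a \<le> \<rho> a'"
      then have "a' \<in> {s\<in>L2. \<rho> s < \<rho> a}" "{s\<in>L2. \<rho> s < \<rho> a'} \<subseteq> {s\<in>L2. \<rho> s < \<rho> a}"
        using that by auto
      then have "{s\<in>L2. \<rho> s < \<rho> a'} \<subset> {s\<in>L2. \<rho> s < \<rho> a}" by blast
      then have "rank a' < rank a" unfolding rank_def using fin(2) by (simp add: psubset_card_mono)
      then show False using le by simp
    qed
  qed
  define f where "f v k = (case k of
      Root \<Rightarrow> x
    | Layer \<Rightarrow> if v = x then 0 else if v \<in> L1 then 1 else if v \<in> L2 then 2 else 3
    | Pos \<Rightarrow> if v \<in> L1 then p v else if v \<in> L2 then pos v else 0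
    | Lo \<Rightarrow> if v \<in> L2 then lo v else if v \<in> L3 then l v else 0
    | Hi \<Rightarrow> if v \<in> L2 then hi v else if v \<in> L3 then h v else 0
    | Rank \<Rightarrow> if v \<in> L2 then rank v else 0
    | Ptr \<Rightarrow> if v \<in> L3 then a0 v else x)" for v k
  have "f v Root \<in> K \<and> f v Ptr \<in> K" for v
    using w unfolding f_def K_def by auto
  moreover have "f v k \<in> K \<or> f v k \<le> card V + 3" for v k
  proof (cases k)
    case Root
    then show ?thesis unfolding f_def K_def by auto
  next
    case Ptr
    then show ?thesis using w unfolding f_def K_def by auto
  next
    case Pos
    then show ?thesis using p(1) pos cardV bspec[OF p(1), of v] bspec[OF pos, of v] unfolding f_def by auto
  next
    case Lo
    then show ?thesis using int[of v] w[of v] cardV unfolding f_def by auto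
  next
    case Hi
    then show ?thesis using int[of v] w[of v] cardV unfolding f_def by auto
  next
    case Rank
    then show ?thesis using rank[of v] cardV unfolding f_def by auto
  next
    case Layer
    then show ?thesis unfolding f_def by auto
  qed
  moreover have lay: "f v Layer = 0 \<longleftrightarrow> v = x" "f v Layer = 1 \<longleftrightarrow> v \<in> L1"
      "f v Layer = 2 \<longleftrightarrow> v \<in> L2" "f v Layer = 3 \<longleftrightarrow> v \<in> L3" if "v \<in> K" for v
    using disj that unfolding f_def K_def by auto
  have inner: "inner f b a \<longleftrightarrow> b \<in> L1 \<and> a \<in> L2 \<and> adj b a" if "b \<in> K" "a \<in> K" for a b
  proof (cases "b \<in> L1 \<and> a \<in> L2")
    case True
    then have "b \<notin> L2" using disj by blast
    have "adj b a \<longleftrightarrow> b \<in> nbh a" using adj_sym unfolding nbh_def by blast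
    also have "\<dots> \<longleftrightarrow> f a Lo \<le> f b Pos \<and> f b Pos < f a Hi"
      using int[of a] True unfolding f_def by simp
    finally show ?thesis using True lay[OF that(1)] lay[OF that(2)]
      unfolding inner_def by (simp add: f_def)
  next
    case False
    then show ?thesis using lay[OF that(1)] lay[OF that(2)] unfolding inner_def by blast
  qed
  have inners: "{b\<in>K. inner f b a} = nbh a \<inter> L1" if "a \<in> L2" for a
  proof -
    have "a \<in> K" using that unfolding K_def by blast
    then show ?thesis using inner[OF _ \<open>a \<in> K\<close>] that adj_sym unfolding nbh_def K_def by blast
  qed
  have outer: "outer K f a u \<longleftrightarrow> a \<in> L2 \<and> u \<in> L3 \<and> adj a u" if "a \<in> K" "u \<in> K" for a u
  proof (cases "a \<in> L2 \<and> u \<in> L3")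
    case True
    then have a: "a \<in> L2" and u: "u \<in> L3" and n: "u \<notin> L1" "u \<notin> L2" "a \<notin> L1" "u \<noteq> x" using disj by blast+
    have "a0 u \<in> L2" using w u by blast
    then have "above (\<lambda>a. {b\<in>K. inner f b a}) (\<lambda>a. f a Rank) (a0 u) a
        \<longleftrightarrow> above (\<lambda>a. nbh a \<inter> L1) \<rho> (a0 u) a"
      unfolding above_def using a rank_le by (simp add: inners f_def)
    moreover have "f u Ptr = a0 u" "f u Hi = h u" "f u Lo = l u" "f a Pos = pos a"
      using a u n unfolding f_def by simp_all
    moreover have "adj a u \<longleftrightarrow> u \<in> nbh a" unfolding nbh_def by simp
    ultimately show ?thesis using w[OF u] a u lay[OF that(1)] lay[OF that(2)]
      unfolding outer_def by (simp add: f_def)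
  next
    case False
    then show ?thesis using lay[OF that(1)] lay[OF that(2)] unfolding outer_def by blast
  qed
  have "arc K f u v \<longleftrightarrow> u = x \<and> v \<in> L1 \<or> u \<in> L1 \<and> v \<in> L2 \<and> adj u v \<or> u \<in> L2 \<and> v \<in> L3 \<and> adj u v"
    if "u \<in> K" "v \<in> K" for u v
    using inner[OF that] outer[OF that] lay[OF that(1)] lay[OF that(2)]
    unfolding arc_def by (simp add: f_def)
  then have "\<forall>u\<in>K. \<forall>v\<in>K. adj u v \<longleftrightarrow> arc K f u v \<or> arc K f v u"
    using edges by simp
  ultimately have "labels K (card V + 3) adj f" unfolding labels_def by blast
  then show ?thesis using KW closedK unfolding K_def by blast
qed

lemma labels_closed:
  assumes "W \<subseteq> V" "\<forall>u\<in>W. \<forall>v. adj u v \<longrightarrow> v \<in> W"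
  shows "\<exists>f. labels W (card V + 3) adj f"
  using assms
proof (induction "card W" arbitrary: W rule: less_induct)
  case less
  show ?case
  proof (cases "W = {}")
    case True
    then show ?thesis unfolding labels_def by simp
  next
    case False
    obtain K f where K: "K \<subseteq> W" "K \<noteq> {}" "\<forall>u\<in>K. \<forall>v. adj u v \<longrightarrow> v \<in> K"
      and f: "labels K (card V + 3) adj f"
      using labels_one_component[OF less.prems(1) False less.prems(2)] by blast
    have "finite W" using less.prems(1) finV finite_subset by blast
    then have "card (W - K) < card W" using K by (intro psubset_card_mono) auto
    moreover have "W - K \<subseteq> V" using less.prems(1) by blast
    moreover have "\<forall>u\<in>W - K. \<forall>v. adj u v \<longrightarrow> v \<in> W - K"
      using less.prems(2) K(3) adj_sym by blast
    ultimately obtain g where g: "labels (W - K) (card V + 3) adj g"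
      using less.hyps by blast
    have "labels (K \<union> (W - K)) (card V + 3) adj (\<lambda>v. if v \<in> K then f v else g v)"
      using K(3) adj_sym by (intro labels_Un[OF f g]) blast+
    moreover have "K \<union> (W - K) = W" using K(1) by blast
    ultimately show ?thesis by metis
  qed
qed

lemma labels_exist: "\<exists>f. labels V (card V + 3) adj f"
  using labels_closed[of V] adjV by blast

end

section \<open>Induced subgraphs as embeddings\<close>

lemma contains_induced_iff_embedding:
  "contains_induced G H \<longleftrightarrow> (\<exists>g. inj_on g (verts H) \<and> g ` verts H \<subseteq> verts G \<and>
    (\<forall>u\<in>verts H. \<forall>v\<in>verts H. {u, v} \<in> edges H \<longleftrightarrow> {g u, g v} \<in> edges G))"
proof
  assume "contains_induced G H"
  then obtain W f where W: "W \<subseteq> verts G" and f: "bij_betw f W (verts H)"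
    and e: "\<And>u v. u \<in> W \<Longrightarrow> v \<in> W \<Longrightarrow> {u, v} \<in> edges G \<longleftrightarrow> {f u, f v} \<in> edges H"
    unfolding contains_induced_def graph_iso_def induced_subgraph_def by auto
  let ?g = "inv_into W f"
  have "bij_betw ?g (verts H) W" using f by (rule bij_betw_inv_into)
  then have g: "inj_on ?g (verts H)" "?g ` verts H = W" by (auto simp: bij_betw_def)
  moreover have "{u, v} \<in> edges H \<longleftrightarrow> {?g u, ?g v} \<in> edges G"
    if "u \<in> verts H" "v \<in> verts H" for u v
    using e[of "?g u" "?g v"] g(2) that f by (metis bij_betw_inv_into_right imageI)
  ultimately show "\<exists>g. inj_on g (verts H) \<and> g ` verts H \<subseteq> verts G \<and>
    (\<forall>u\<in>verts H. \<forall>v\<in>verts H. {u, v} \<in> edges H \<longleftrightarrow> {g u, g v} \<in> edges G)"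
    using W by blast
next
  assume "\<exists>g. inj_on g (verts H) \<and> g ` verts H \<subseteq> verts G \<and>
    (\<forall>u\<in>verts H. \<forall>v\<in>verts H. {u, v} \<in> edges H \<longleftrightarrow> {g u, g v} \<in> edges G)"
  then obtain g where g: "inj_on g (verts H)" "g ` verts H \<subseteq> verts G"
    "\<forall>u\<in>verts H. \<forall>v\<in>verts H. {u, v} \<in> edges H \<longleftrightarrow> {g u, g v} \<in> edges G" by blast
  let ?W = "g ` verts H" and ?f = "inv_into (verts H) g"
  have "bij_betw ?f ?W (verts H)"
    using g(1) by (simp add: bij_betw_inv_into inj_on_imp_bij_betw)
  moreover have "\<forall>u\<in>?W. \<forall>v\<in>?W. {u, v} \<in> edges G \<longleftrightarrow> {?f u, ?f v} \<in> edges H"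
    using g(1,3) by auto
  ultimately show "contains_induced G H"
    using g(2) unfolding contains_induced_def graph_iso_def induced_subgraph_def
    by (intro exI[of _ ?W]) auto
qed

lemma contains_induced_trans:
  assumes "contains_induced G H" "contains_induced H F"
  shows "contains_induced G F"
proof -
  obtain g where g: "inj_on g (verts H)" "g ` verts H \<subseteq> verts G"
    "\<forall>u\<in>verts H. \<forall>v\<in>verts H. {u, v} \<in> edges H \<longleftrightarrow> {g u, g v} \<in> edges G"
    using assms(1) unfolding contains_induced_iff_embedding by blast
  obtain h where h: "inj_on h (verts F)" "h ` verts F \<subseteq> verts H"
    "\<forall>u\<in>verts F. \<forall>v\<in>verts F. {u, v} \<in> edges F \<longleftrightarrow> {h u, h v} \<in> edges H"
    using assms(2) unfolding contains_induced_iff_embedding by blast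
  have "inj_on (g \<circ> h) (verts F)" using comp_inj_on[OF h(1)] inj_on_subset[OF g(1) h(2)] by blast
  moreover have "(g \<circ> h) ` verts F \<subseteq> verts G" using g(2) h(2) by auto
  moreover have "{u, v} \<in> edges F \<longleftrightarrow> {(g \<circ> h) u, (g \<circ> h) v} \<in> edges G"
    if "u \<in> verts F" "v \<in> verts F" for u v
  proof -
    have "h u \<in> verts H" "h v \<in> verts H" using h(2) that by auto
    then show ?thesis using h(3) g(3) that by auto
  qed
  ultimately show ?thesis unfolding contains_induced_iff_embedding by blast
qed

lemma bipartite_iff_colouring:
  assumes "simple_graph G"
  shows "bipartite G \<longleftrightarrow> (\<exists>c :: _ \<Rightarrow> bool. \<forall>u v. {u, v} \<in> edges G \<longrightarrow> c u \<noteq> c v)"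
proof
  assume "bipartite G"
  then obtain A B where AB: "A \<union> B = verts G" "A \<inter> B = {}"
    "\<forall>e\<in>edges G. \<exists>a\<in>A. \<exists>b\<in>B. e = {a, b}" unfolding bipartite_def by blast
  have "(u \<in> A) \<noteq> (v \<in> A)" if uv: "{u, v} \<in> edges G" for u v
  proof -
    obtain a b where "a \<in> A" "b \<in> B" "{u, v} = {a, b}" using AB(3) uv by blast
    then show ?thesis using AB(2) by (auto simp: doubleton_eq_iff)
  qed
  then show "\<exists>c :: _ \<Rightarrow> bool. \<forall>u v. {u, v} \<in> edges G \<longrightarrow> c u \<noteq> c v"
    by (intro exI[of _ "\<lambda>u. u \<in> A"]) blast
next
  assume "\<exists>c :: _ \<Rightarrow> bool. \<forall>u v. {u, v} \<in> edges G \<longrightarrow> c u \<noteq> c v"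
  then obtain c :: "_ \<Rightarrow> bool" where c: "\<forall>u v. {u, v} \<in> edges G \<longrightarrow> c u \<noteq> c v" by blast
  have "\<exists>a\<in>{v\<in>verts G. c v}. \<exists>b\<in>{v\<in>verts G. \<not> c v}. e = {a, b}" if e: "e \<in> edges G" for e
  proof -
    obtain u v where uv: "u \<in> verts G" "v \<in> verts G" "e = {u, v}"
      using assms e unfolding simple_graph_def by blast
    then show ?thesis using c e by (cases "c u") (auto simp: insert_commute)
  qed
  then show "bipartite G" unfolding bipartite_def
    by (intro exI[of _ "{v\<in>verts G. c v}"] exI[of _ "{v\<in>verts G. \<not> c v}"]) auto
qed

lemma bipartite_induced:
  assumes G: "simple_graph G" "bipartite G" and H: "simple_graph H" "contains_induced G H"
  shows "bipartite H"
proof -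
  obtain c :: "_ \<Rightarrow> bool" where c: "\<forall>u v. {u, v} \<in> edges G \<longrightarrow> c u \<noteq> c v"
    using iffD1[OF bipartite_iff_colouring[OF G(1)] G(2)] by metis
  obtain g where g:
    "\<forall>u\<in>verts H. \<forall>v\<in>verts H. {u, v} \<in> edges H \<longleftrightarrow> {g u, g v} \<in> edges G"
    using H(2) unfolding contains_induced_iff_embedding by blast
  have "(c \<circ> g) u \<noteq> (c \<circ> g) v" if uv: "{u, v} \<in> edges H" for u v
  proof -
    have "u \<in> verts H" "v \<in> verts H"
      using H(1) uv unfolding simple_graph_def by (auto simp: doubleton_eq_iff)
    then show ?thesis using c g uv by simp
  qed
  then show ?thesis using bipartite_iff_colouring[OF H(1)] by blast
qed

section \<open>The class of graphs and its upper bound\<close>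

definition P7_domino_free_graphs :: "nat graph set" where
  "P7_domino_free_graphs =
    {G. simple_graph G \<and> bipartite G \<and> free2 (path_graph 7) domino G}"

lemma hereditary_P7_domino_free: "hereditary P7_domino_free_graphs"
  unfolding hereditary_def
proof (intro conjI ballI allI impI)
  fix G H :: "nat graph"
  assume G: "G \<in> P7_domino_free_graphs" and H: "simple_graph H" "contains_induced G H"
  then have G: "simple_graph G" "bipartite G" "free2 (path_graph 7) domino G"
    unfolding P7_domino_free_graphs_def by simp_all
  have "free2 (path_graph 7) domino H"
    using G(3) contains_induced_trans[OF H(2), of "path_graph 7"]
      contains_induced_trans[OF H(2), of domino] unfolding free2_def by argo
  then show "H \<in> P7_domino_free_graphs"
    using H(1) bipartite_induced[OF G(1,2) H] unfolding P7_domino_free_graphs_def by simp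
qed (simp add: P7_domino_free_graphs_def)

lemma path_graph_edge:
  "{u, v} \<in> edges (path_graph k) \<longleftrightarrow> 1 \<le> u \<and> u < k \<and> v = u + 1 \<or> 1 \<le> v \<and> v < k \<and> u = v + 1"
  unfolding path_graph_def by (auto simp: doubleton_eq_iff)

text \<open>
  Each forbidden pattern of vertices, listed in order, is an embedding of the forbidden graph: the
  missing edges inside a colour class and the distinctness of the vertices are supplied by the
  colouring and the given adjacencies.
\<close>

lemma P7_domino_free_bigraph_edges:
  assumes G: "simple_graph G" "free2 (path_graph 7) domino G"
    and c: "\<And>u v. {u, v} \<in> edges G \<Longrightarrow> c u \<noteq> c v"
  shows "P7_domino_free_bigraph (verts G) (\<lambda>u v. {u, v} \<in> edges G) c"
proof
  show "finite (verts G)" using G unfolding simple_graph_def by blast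
  show V: "u \<in> verts G \<and> v \<in> verts G" if "{u, v} \<in> edges G" for u v
    using G that unfolding simple_graph_def by (auto simp: doubleton_eq_iff)
  show "{v, u} \<in> edges G" if "{u, v} \<in> edges G" for u v using that by (simp add: insert_commute)
  show "c u \<noteq> c v" if "{u, v} \<in> edges G" for u v using c that .
  have same: "{u, v} \<notin> edges G" if "c u = c v" for u v using c that by blast
  show False
    if e: "{x1, x2} \<in> edges G" "{x2, x3} \<in> edges G" "{x3, x4} \<in> edges G" "{x4, x5} \<in> edges G"
      "{x5, x6} \<in> edges G" "{x6, x7} \<in> edges G"
    and n: "{x1, x4} \<notin> edges G" "{x1, x6} \<notin> edges G" "{x2, x5} \<notin> edges G"
      "{x2, x7} \<notin> edges G" "{x3, x6} \<notin> edges G" "{x4, x7} \<notin> edges G"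
    for x1 x2 x3 x4 x5 x6 x7
  proof -
    define g where "g i = [x1, x2, x3, x4, x5, x6, x7] ! (i - 1)" for i :: nat
    have gs: "g 1 = x1" "g 2 = x2" "g 3 = x3" "g 4 = x4" "g 5 = x5" "g 6 = x6" "g 7 = x7"
      unfolding g_def by simp_all
    have cs: "c x2 = (\<not> c x1)" "c x3 = c x1" "c x4 = (\<not> c x1)" "c x5 = c x1"
      "c x6 = (\<not> c x1)" "c x7 = c x1"
      using e[THEN c] by blast+
    have V7: "verts (path_graph 7) = {1, 2, 3, 4, 5, 6, 7}"
      unfolding path_graph_def by auto
    have ns: "{x1, x3} \<notin> edges G" "{x1, x5} \<notin> edges G" "{x1, x7} \<notin> edges G"
      "{x3, x5} \<notin> edges G" "{x3, x7} \<notin> edges G" "{x5, x7} \<notin> edges G"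
      "{x2, x4} \<notin> edges G" "{x2, x6} \<notin> edges G" "{x4, x6} \<notin> edges G"
      "{v} \<notin> edges G" for v
      using same cs same[of v v] by simp_all
    have dist: "x1 \<noteq> x3" "x1 \<noteq> x5" "x1 \<noteq> x7" "x3 \<noteq> x5" "x3 \<noteq> x7" "x5 \<noteq> x7"
      "x2 \<noteq> x4" "x2 \<noteq> x6" "x4 \<noteq> x6"
      using e n by (metis insert_commute)+
    have "inj_on g (verts (path_graph 7))"
      unfolding V7 using dist cs by (auto simp: inj_on_def gs simp del: One_nat_def)
    moreover have "g ` verts (path_graph 7) \<subseteq> verts G"
      unfolding V7 using e[THEN V] by (auto simp: gs simp del: One_nat_def)
    moreover have "\<forall>u\<in>verts (path_graph 7). \<forall>v\<in>verts (path_graph 7).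
        {u, v} \<in> edges (path_graph 7) \<longleftrightarrow> {g u, g v} \<in> edges G"
      unfolding V7 path_graph_edge using e n ns
      by (simp add: gs insert_commute del: One_nat_def)
    ultimately show False
      using G(2) unfolding free2_def contains_induced_iff_embedding by blast
  qed
  show False
    if e: "{x1, y1} \<in> edges G" "{x1, y2} \<in> edges G" "{x2, y1} \<in> edges G" "{x2, y2} \<in> edges G"
      "{x2, y3} \<in> edges G" "{x3, y2} \<in> edges G" "{x3, y3} \<in> edges G"
    and n: "{x1, y3} \<notin> edges G" "{x3, y1} \<notin> edges G"
    for x1 x2 x3 y1 y2 y3
  proof -
    define g :: "nat + nat \<Rightarrow> nat" where
      "g = case_sum (\<lambda>i. [x1, x2, x3] ! (i - 1)) (\<lambda>i. [y1, y2, y3] ! (i - 1))"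
    have gs: "g (Inl 1) = x1" "g (Inl 2) = x2" "g (Inl 3) = x3"
      "g (Inr 1) = y1" "g (Inr 2) = y2" "g (Inr 3) = y3"
      unfolding g_def by simp_all
    have cs: "c y1 = (\<not> c x1)" "c y2 = (\<not> c x1)" "c y3 = (\<not> c x1)" "c x2 = c x1" "c x3 = c x1"
      using e[THEN c] by blast+
    have VD: "verts domino = {Inl 1, Inl 2, Inl 3, Inr 1, Inr 2, Inr 3}"
      unfolding domino_def by auto
    have ns: "{x1, x2} \<notin> edges G" "{x1, x3} \<notin> edges G" "{x2, x3} \<notin> edges G"
      "{y1, y2} \<notin> edges G" "{y1, y3} \<notin> edges G" "{y2, y3} \<notin> edges G"
      "{v} \<notin> edges G" for v
      using same cs same[of v v] by simp_all
    have dist: "x1 \<noteq> x2" "x1 \<noteq> x3" "x2 \<noteq> x3" "y1 \<noteq> y2" "y1 \<noteq> y3" "y2 \<noteq> y3"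
      using e n by (metis insert_commute)+
    have "inj_on g (verts domino)"
      unfolding VD using dist cs by (auto simp: inj_on_def gs simp del: One_nat_def)
    moreover have "g ` verts domino \<subseteq> verts G"
      unfolding VD using e[THEN V] by (auto simp: gs simp del: One_nat_def)
    moreover have "\<forall>u\<in>verts domino. \<forall>v\<in>verts domino.
        {u, v} \<in> edges domino \<longleftrightarrow> {g u, g v} \<in> edges G"
      unfolding VD using e n ns
      by (simp add: gs domino_def insert_commute doubleton_eq_iff del: One_nat_def)
    ultimately show False
      using G(2) unfolding free2_def contains_induced_iff_embedding by blast
  qed
qed

lemma UNIV_field: "(UNIV :: field set) = {Root, Layer, Pos, Lo, Hi, Rank, Ptr}"
proof -
  have "k \<in> {Root, Layer, Pos, Lo, Hi, Rank, Ptr}" for k by (cases k) auto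
  then show ?thesis by blast
qed

lemma simple_graph_eqI:
  assumes "simple_graph G" "simple_graph H" "verts G = verts H"
    and "\<And>u v. u \<in> verts G \<Longrightarrow> v \<in> verts G \<Longrightarrow> {u, v} \<in> edges G \<longleftrightarrow> {u, v} \<in> edges H"
  shows "G = H"
proof (rule prod_eqI)
  show "edges G = edges H"
  proof (intro set_eqI iffI)
    fix e
    assume "e \<in> edges G"
    moreover obtain u v where "u \<in> verts G" "v \<in> verts G" "e = {u, v}"
      using assms(1) calculation unfolding simple_graph_def by blast
    ultimately show "e \<in> edges H" using assms(4) by simp
  next
    fix e
    assume "e \<in> edges H"
    moreover obtain u v where "u \<in> verts H" "v \<in> verts H" "e = {u, v}"
      using assms(2) calculation unfolding simple_graph_def by blast
    ultimately show "e \<in> edges G" using assms(3,4) by simp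
  qed
qed (fact assms(3))

text \<open>
  A labelling assigns a number at most \<open>n + 3\<close> to each of \<open>7 * n\<close> pairs of a vertex and a field,
  and different graphs have different labellings.
\<close>

lemma card_labelled_le:
  "finite (labelled_graphs P7_domino_free_graphs n) \<and>
    card (labelled_graphs P7_domino_free_graphs n) \<le> (n + 4) ^ (7 * n)"
proof -
  let ?L = "labelled_graphs P7_domino_free_graphs n"
  let ?D = "{1..n} \<times> (UNIV :: field set)"
  define code where "code G = (SOME f. labels {1..n} (n + 3) (\<lambda>u v. {u, v} \<in> edges G) f)"
    for G :: "nat graph"
  define enc where "enc G = restrict (\<lambda>(v, k). code G v k) ?D" for G :: "nat graph"
  have code: "labels {1..n} (n + 3) (\<lambda>u v. {u, v} \<in> edges G) (code G)" if "G \<in> ?L" for G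
  proof -
    have G: "simple_graph G" "bipartite G" "free2 (path_graph 7) domino G" "verts G = {1..n}"
      using that unfolding labelled_graphs_def P7_domino_free_graphs_def by auto
    obtain c :: "nat \<Rightarrow> bool" where "\<forall>u v. {u, v} \<in> edges G \<longrightarrow> c u \<noteq> c v"
      using iffD1[OF bipartite_iff_colouring[OF G(1)] G(2)] by metis
    then interpret P7_domino_free_bigraph "verts G" "\<lambda>u v. {u, v} \<in> edges G" c
      using P7_domino_free_bigraph_edges G by blast
    have "\<exists>f. labels {1..n} (n + 3) (\<lambda>u v. {u, v} \<in> edges G) f"
      using labels_exist unfolding G(4) by simp
    then show ?thesis unfolding code_def by (rule someI_ex)
  qed
  have "inj_on enc ?L"
  proof (rule inj_onI)
    fix G H assume GH: "G \<in> ?L" "H \<in> ?L" "enc G = enc H"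
    have eq: "code G v k = code H v k" if "v \<in> {1..n}" for v k
      using fun_cong[OF GH(3), of "(v, k)"] that unfolding enc_def by simp
    have inn: "inner (code G) u v = inner (code H) u v" if "u \<in> {1..n}" "v \<in> {1..n}" for u v
      using eq that unfolding inner_def by simp
    have "outer {1..n} (code G) u v = outer {1..n} (code H) u v" if "u \<in> {1..n}" "v \<in> {1..n}" for u v
    proof -
      have "code H v Ptr \<in> {1..n}" using code[OF GH(2)] that unfolding labels_def by blast
      moreover have "{b\<in>{1..n}. inner (code G) b a} = {b\<in>{1..n}. inner (code H) b a}"
        if "a \<in> {1..n}" for a using inn that by blast
      ultimately show ?thesis using eq that unfolding outer_def above_def by simp
    qed
    then have "arc {1..n} (code G) u v = arc {1..n} (code H) u v"
      if "u \<in> {1..n}" "v \<in> {1..n}" for u v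
      using eq inn that unfolding arc_def by simp
    then have "{u, v} \<in> edges G \<longleftrightarrow> {u, v} \<in> edges H" if "u \<in> {1..n}" "v \<in> {1..n}" for u v
      using code[OF GH(1)] code[OF GH(2)] that unfolding labels_def by simp
    then show "G = H" using GH(1,2)
      unfolding labelled_graphs_def P7_domino_free_graphs_def by (intro simple_graph_eqI) auto
  qed
  moreover have "enc ` ?L \<subseteq> ?D \<rightarrow>\<^sub>E {..n + 3}"
  proof -
    have "code G v k \<le> n + 3" if "G \<in> ?L" "v \<in> {1..n}" for G v k
    proof -
      have "code G v k \<in> {1..n} \<or> code G v k \<le> n + 3"
        using code[OF that(1)] that(2) unfolding labels_def by blast
      then show ?thesis by auto
    qed
    then show ?thesis unfolding enc_def by (auto split: if_splits)
  qed
  moreover have fin: "finite ?D" "card ?D = n * 7"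
    unfolding UNIV_field by (simp_all add: card_cartesian_product)
  moreover have "finite (?D \<rightarrow>\<^sub>E {..n + 3})" using fin by (intro finite_PiE) auto
  moreover have "card (?D \<rightarrow>\<^sub>E {..n + 3}) = (n + 4) ^ (7 * n)"
    using fin by (simp add: card_funcsetE mult.commute add.commute)
  ultimately show ?thesis by (metis card_inj_on_le inj_on_finite)
qed

section \<open>The lower bound\<close>

text \<open>
  The vertices up to \<open>k\<close> are the centres, and \<open>f\<close> attaches each other vertex to a centre.
\<close>

definition star_forest :: "nat \<Rightarrow> nat \<Rightarrow> (nat \<Rightarrow> nat) \<Rightarrow> nat graph" where
  "star_forest k n f = ({1..n}, {{i, f i} |i. i \<in> {k<..n}})"

text \<open>
  Both forbidden graphs have a path on four vertices, whose middle edge joins two vertices of degree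
  at least 2. In a star forest every edge has an end of degree 1.
\<close>

lemma not_contains_induced_path4:
  assumes leaf: "\<And>u v. {u, v} \<in> edges G \<Longrightarrow>
      (\<forall>w. {u, w} \<in> edges G \<longrightarrow> w = v) \<or> (\<forall>w. {v, w} \<in> edges G \<longrightarrow> w = u)"
    and path: "{a, b, c, d} \<subseteq> verts H" "a \<noteq> c" "b \<noteq> d"
      "{a, b} \<in> edges H" "{b, c} \<in> edges H" "{c, d} \<in> edges H"
  shows "\<not> contains_induced G H"
proof
  assume "contains_induced G H"
  then obtain g where g: "inj_on g (verts H)"
    "\<forall>u\<in>verts H. \<forall>v\<in>verts H. {u, v} \<in> edges H \<longleftrightarrow> {g u, g v} \<in> edges G"
    unfolding contains_induced_iff_embedding by blast
  have "{g b, g a} \<in> edges G" "{g b, g c} \<in> edges G" "{g c, g d} \<in> edges G"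
    using g(2) path by (auto simp: insert_commute)
  moreover have "g a \<noteq> g c" "g b \<noteq> g d" using g(1) path by (auto simp: inj_on_eq_iff)
  ultimately show False using leaf[of "g b" "g c"] by metis
qed

lemma star_forest_labelled:
  assumes f: "f \<in> {k<..n} \<rightarrow> {1..k}" and k: "k \<le> n"
  shows "star_forest k n f \<in> labelled_graphs P7_domino_free_graphs n"
proof -
  let ?G = "star_forest k n f"
  have fk: "1 \<le> f i" "f i \<le> k" if "k < i" "i \<le> n" for i using f that by (auto simp: Pi_iff)
  have edge: "{u, v} \<in> edges ?G \<longleftrightarrow> k < u \<and> u \<le> n \<and> v = f u \<or> k < v \<and> v \<le> n \<and> u = f v" for u v
    unfolding star_forest_def by (auto simp: doubleton_eq_iff)
  have simple: "simple_graph ?G"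
    unfolding simple_graph_def
  proof (intro conjI ballI)
    show "finite (verts ?G)" unfolding star_forest_def by simp
    fix e assume "e \<in> edges ?G"
    then obtain i where i: "k < i" "i \<le> n" "e = {i, f i}" unfolding star_forest_def by auto
    then have "i \<in> verts ?G" "f i \<in> verts ?G" "i \<noteq> f i"
      using fk[OF i(1,2)] k unfolding star_forest_def by auto
    then show "\<exists>u\<in>verts ?G. \<exists>v\<in>verts ?G. u \<noteq> v \<and> e = {u, v}" using i(3) by blast
  qed
  moreover have "bipartite ?G"
    unfolding bipartite_iff_colouring[OF simple] edge using fk
    by (intro exI[of _ "\<lambda>u. k < u"]) (auto simp: not_less)
  moreover have leaf: "(\<forall>w. {u, w} \<in> edges ?G \<longrightarrow> w = v) \<or> (\<forall>w. {v, w} \<in> edges ?G \<longrightarrow> w = u)"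
    if "{u, v} \<in> edges ?G" for u v
    using that fk unfolding edge by (metis not_less)
  have "\<not> contains_induced ?G (path_graph 7)"
    by (rule not_contains_induced_path4[OF leaf, where a = 1 and b = 2 and c = 3 and d = 4])
      (auto simp: path_graph_edge, auto simp: path_graph_def)
  moreover have "\<not> contains_induced ?G domino"
    by (rule not_contains_induced_path4[OF leaf, where a = "Inl 1" and b = "Inr 1" and c = "Inl 2" and d = "Inr 2"])
      (auto simp: domino_def)
  moreover have "verts ?G = {1..n}" unfolding star_forest_def by simp
  ultimately show ?thesis
    unfolding labelled_graphs_def P7_domino_free_graphs_def free2_def by simp
qed

lemma card_labelled_ge:
  assumes k: "k \<le> n"
  shows "k ^ (n - k) \<le> card (labelled_graphs P7_domino_free_graphs n)"
proof -
  let ?F = "{k<..n} \<rightarrow>\<^sub>E {1..k}"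
  have "inj_on (star_forest k n) ?F"
  proof (rule inj_onI)
    fix f g assume fg: "f \<in> ?F" "g \<in> ?F" "star_forest k n f = star_forest k n g"
    have "f i = g i" if i: "i \<in> {k<..n}" for i
    proof -
      have "{i, f i} \<in> edges (star_forest k n g)"
        using i unfolding fg(3)[symmetric] by (auto simp: star_forest_def)
      then obtain j where j: "j \<in> {k<..n}" "{i, f i} = {j, g j}" unfolding star_forest_def by auto
      have "g j \<le> k" using fg(2) j(1) by (auto simp: PiE_iff)
      then show ?thesis using j i by (auto simp: doubleton_eq_iff)
    qed
    then show "f = g" using fg(1,2) by (intro PiE_ext) auto
  qed
  moreover have "star_forest k n ` ?F \<subseteq> labelled_graphs P7_domino_free_graphs n"
    using star_forest_labelled[OF _ k] by (auto simp: PiE_def)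
  moreover have "card ?F = k ^ (n - k)" by (simp add: card_funcsetE)
  ultimately show ?thesis using card_inj_on_le card_labelled_le by metis
qed

section \<open>Factorial growth\<close>

text \<open>
  Taking \<open>k = n div 2\<close> in the lower bound, and \<open>k\<^sup>2 \<ge> n\<close> for \<open>n \<ge> 16\<close>, gives at least
  \<open>n powr (n / 4)\<close> graphs. In the upper bound \<open>n + c \<le> n\<^sup>2\<close> for large \<open>n\<close>. So the exponent to the
  base 2 lies between two constant multiples of \<open>n * ln n\<close>.
\<close>

lemma factorial_classI:
  assumes her: "hereditary X"
    and lower: "\<And>k n. k \<le> n \<Longrightarrow> k ^ (n - k) \<le> card (labelled_graphs X n)"
    and upper: "\<And>n. card (labelled_graphs X n) \<le> (n + c) ^ (d * n)"
  shows "factorial_class X"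
proof -
  define N where "N n = card (labelled_graphs X n)" for n
  define f where "f n = log 2 (real (N n))" for n
  have pos: "0 < N n" if n: "n > 0" for n
  proof -
    have "1 ^ (n - 1) \<le> N n" unfolding N_def using lower[of 1 n] n by simp
    then show ?thesis by simp
  qed
  have lo: "1 / 4 * \<bar>real n * ln (real n)\<bar> \<le> \<bar>f n\<bar>" if n: "n \<ge> 16" for n
  proof -
    let ?k = "n div 2"
    have kn: "n \<le> ?k * ?k"
    proof -
      have "n \<le> 2 * ?k + 1" "8 \<le> ?k" using n by linarith+
      moreover have "8 * ?k \<le> ?k * ?k" using \<open>8 \<le> ?k\<close> by (rule mult_right_mono) simp
      ultimately show ?thesis by linarith
    qed
    have "real n \<le> real ?k ^ 2" using kn by (metis of_nat_le_iff of_nat_power power2_eq_square)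
    then have "ln (real n) \<le> ln (real ?k ^ 2)" using n by (intro ln_mono) auto
    then have 1: "ln (real n) \<le> 2 * ln (real ?k)" using n by (simp add: ln_realpow)
    have k1: "0 \<le> ln (real ?k)" using n by simp
    have half: "real n \<le> 2 * real (n - ?k)" by linarith
    have "real n * ln (real n) \<le> 2 * real (n - ?k) * (2 * ln (real ?k))"
      using 1 half n by (intro mult_mono) auto
    also have "\<dots> = 4 * ln (real (?k ^ (n - ?k)))" using n by (simp add: ln_realpow)
    also have "\<dots> \<le> 4 * ln (real (N n))"
      using lower[of ?k n] n pos[of n] unfolding N_def[symmetric]
      by (intro mult_left_mono ln_mono) (auto simp del: of_nat_power)
    finally have 2: "real n * ln (real n) \<le> 4 * ln (real (N n))" .
    have N1: "0 \<le> ln (real (N n))" using pos[of n] n by simp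
    \<comment> \<open>Here \<open>ln 2 < 1\<close> makes the logarithm to the base 2 the larger one.\<close>
    have "ln (real (N n)) \<le> f n"
      unfolding f_def log_def using N1 ln_2_less_1 ln_gt_zero[of "2::real"]
      by (simp add: pos_le_divide_eq mult_left_le)
    then show ?thesis using 2 n N1 by (simp add: abs_of_nonneg)
  qed
  have up: "\<bar>f n\<bar> \<le> (2 * real d / ln 2) * \<bar>real n * ln (real n)\<bar>" if n: "n \<ge> c + 2" for n
  proof -
    have N1: "1 \<le> real (N n)" using pos[of n] n by simp
    have "n + c \<le> n * 2" using n by simp
    also have "\<dots> \<le> n * n" using n by (intro mult_left_mono) auto
    finally have "real (n + c) \<le> real n ^ 2" by (metis of_nat_le_iff of_nat_power power2_eq_square)
    then have "ln (real (n + c)) \<le> ln (real n ^ 2)" using n by (intro ln_mono) auto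
    then have 1: "ln (real (n + c)) \<le> 2 * ln (real n)" using n by (simp add: ln_realpow)
    have "real (N n) \<le> real ((n + c) ^ (d * n))" using upper[of n] unfolding N_def of_nat_le_iff .
    then have "ln (real (N n)) \<le> ln (real ((n + c) ^ (d * n)))" using N1 by (intro ln_mono) auto
    also have "\<dots> = real (d * n) * ln (real (n + c))" using n by (simp add: ln_realpow)
    also have "\<dots> \<le> real (d * n) * (2 * ln (real n))" using 1 by (intro mult_left_mono) auto
    finally have "ln (real (N n)) \<le> 2 * real d * (real n * ln (real n))" by simp
    then have "f n \<le> 2 * real d * (real n * ln (real n)) / ln 2"
      unfolding f_def log_def by (intro divide_right_mono) auto
    moreover have "0 \<le> f n" unfolding f_def using N1 by simp
    ultimately show ?thesis using n by simp
  qed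
  have "f \<in> \<Theta>(\<lambda>n. real n * ln (real n))"
  proof (rule bigthetaI)
    show "f \<in> O(\<lambda>n. real n * ln (real n))"
      using up by (intro bigoI[of _ "2 * real d / ln 2"] eventually_sequentiallyI[of "c + 2"]) auto
    show "f \<in> \<Omega>(\<lambda>n. real n * ln (real n))"
      using lo by (intro landau_omega.bigI[of "1/4"] eventually_sequentiallyI[of 16]) auto
  qed
  moreover have "\<forall>\<^sub>F n in sequentially. real (card (labelled_graphs X n)) = 2 powr f n"
    using pos unfolding f_def N_def[symmetric]
    by (intro eventually_sequentiallyI[of 1]) (simp add: powr_log_cancel)
  ultimately show ?thesis using her unfolding factorial_class_def by blast
qed

theorem theorem15:
  shows "factorial_class
    {G :: nat graph. simple_graph G \<and> bipartite G \<and> free2 (path_graph 7) domino G}"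
  using factorial_classI[OF hereditary_P7_domino_free card_labelled_ge
      conjunct2[OF card_labelled_le]]
  unfolding P7_domino_free_graphs_def .

end
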